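(* The class $\mathbb{R}_\infty=\bigcup\{\mathbb{R}_\lambda:\lambda\text{ is a transfinite }\times\text{-number}\}$ is a proper class.
   Context: Work in Morse–Kelley class theory. $\otimes$ is the natural (Hessenberg) product of ordinals; $\lambda$ is a transfinite $\times$-number if $\omega\le\lambda$ and $\beta\otimes\gamma<\lambda$ for all $\beta,\gamma<\lambda$. $\mathbb{Z}_\infty$ is the class of pairs $(\alpha,\beta)$ of ordinals whose Cantor normal forms share no exponent (finite sums $\sum\omega^\zeta c_\zeta$ with integer coefficients), with the corresponding polynomial-style ring operations (exponents added by natural sum) and its order; $\mathbb{Z}_\lambda$ consists of those with both coordinates $<\lambda$. $\mathbb{Q}_\infty$ is the class of pairs $(a,b)$ of Surintegers with $b$ positive nonzero and only $\pm1$ as common divisors, ordered by $(a,b)\preceq(c,d)$ iff $ad\le bc$; $\mathbb{Q}_\lambda$ consists of those with $a,b\in\mathbb{Z}_\lambda$. A $\lambda$-cut is a set $L\subsetneq\mathbb{Q}_\lambda$ with no greatest element such that every element of $L$ is $\prec$ every element of $\mathbb{Q}_\lambda\setminus L$; $\mathbb{R}_\lambda$ is the set of all $\lambda$-cuts. *)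

theory Defs
  imports Main
begin

text \<open>
  Morse--Kelley class theory, with HOL as the ambient logic: the type \<open>'v\<close> is the type of all
  sets, \<open>elts x\<close> is the class of members of the set \<open>x\<close>, and a class is an arbitrary value of
  type \<open>'v set\<close>.  Impredicative class comprehension is thus HOL set comprehension,
  extensionality for classes is that of \<open>'v set\<close>, and (global) choice is the choice operator.
  A class is a set iff it is of the form \<open>elts x\<close>.  Class functions are HOL functions.
\<close>

locale morse_kelley =
  fixes elts :: "'v \<Rightarrow> 'v set"
  assumes extensionality: "elts x = elts y \<Longrightarrow> x = y"
    and regularity: "X \<noteq> {} \<Longrightarrow> \<exists>x\<in>X. elts x \<inter> X = {}"
    and subsets: "X \<subseteq> elts x \<Longrightarrow> \<exists>y. elts y = X"
    and pairing: "\<exists>z. elts z = {x, y}"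
    and union: "\<exists>z. elts z = (\<Union>y\<in>elts x. elts y)"
    and powerset: "\<exists>z. elts z = {y. elts y \<subseteq> elts x}"
    and replacement: "\<exists>z. elts z = F ` elts x"
    and infinity: "\<exists>z. (\<exists>e\<in>elts z. elts e = {}) \<and>
          (\<forall>x\<in>elts z. \<exists>s\<in>elts z. elts s = insert x (elts x))"
begin

definition is_set :: "'v set \<Rightarrow> bool"
  where "is_set X \<longleftrightarrow> (\<exists>x. elts x = X)"

definition proper_class :: "'v set \<Rightarrow> bool"
  where "proper_class X \<longleftrightarrow> \<not> is_set X"

text \<open>The set with the given extension; only meaningful when the class is a set.\<close>

definition vset :: "'v set \<Rightarrow> 'v"
  where "vset X = (THE x. elts x = X)"

definition kpair :: "'v \<Rightarrow> 'v \<Rightarrow> 'v"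
  where "kpair a b = vset {vset {a}, vset {a, b}}"

definition vfst :: "'v \<Rightarrow> 'v"
  where "vfst p = (THE a. \<exists>b. p = kpair a b)"

definition vsnd :: "'v \<Rightarrow> 'v"
  where "vsnd p = (THE b. \<exists>a. p = kpair a b)"


subsection \<open>Ordinals\<close>

definition Ord :: "'v \<Rightarrow> bool"
  where "Ord \<alpha> \<longleftrightarrow> (\<forall>x\<in>elts \<alpha>. elts x \<subseteq> elts \<alpha>) \<and>
    (\<forall>x\<in>elts \<alpha>. \<forall>y\<in>elts \<alpha>. x \<in> elts y \<or> x = y \<or> y \<in> elts x)"

definition olt :: "'v \<Rightarrow> 'v \<Rightarrow> bool"
  where "olt \<alpha> \<beta> \<longleftrightarrow> \<alpha> \<in> elts \<beta>"

definition ole :: "'v \<Rightarrow> 'v \<Rightarrow> bool"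
  where "ole \<alpha> \<beta> \<longleftrightarrow> olt \<alpha> \<beta> \<or> \<alpha> = \<beta>"

primrec ord_of_nat :: "nat \<Rightarrow> 'v" where
  "ord_of_nat 0 = vset {}"
| "ord_of_nat (Suc n) = vset (insert (ord_of_nat n) (elts (ord_of_nat n)))"

definition omega :: 'v
  where "omega = vset (range ord_of_nat)"

abbreviation memrel :: "('v \<times> 'v) set"
  where "memrel \<equiv> {(x, y). x \<in> elts y}"

text \<open>Ordinary (non-commutative) ordinal arithmetic by transfinite recursion on the second
  argument; the recursion equations are derived below.\<close>

definition oadd :: "'v \<Rightarrow> 'v \<Rightarrow> 'v"
  where "oadd \<alpha> = wfrec memrel (\<lambda>f \<beta>. vset (elts \<alpha> \<union> f ` elts \<beta>))"

definition omul :: "'v \<Rightarrow> 'v \<Rightarrow> 'v"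
  where "omul \<alpha> = wfrec memrel (\<lambda>f \<beta>. vset (\<Union>\<gamma>\<in>elts \<beta>. elts (oadd (f \<gamma>) \<alpha>)))"

definition omega_pow :: "'v \<Rightarrow> 'v"
  where "omega_pow = wfrec memrel
    (\<lambda>f \<beta>. vset (elts (ord_of_nat 1) \<union> (\<Union>\<gamma>\<in>elts \<beta>. elts (omul (f \<gamma>) omega))))"

lemma wf_memrel: "wf memrel"
  unfolding wf_eq_minimal
proof (intro allI impI)
  fix Q :: "'v set" and x
  assume "x \<in> Q"
  then have "Q \<noteq> {}" by auto
  from regularity[OF this] show "\<exists>z\<in>Q. \<forall>y. (y, z) \<in> memrel \<longrightarrow> y \<notin> Q" by auto
qed

lemma oadd_rec: "oadd \<alpha> \<beta> = vset (elts \<alpha> \<union> oadd \<alpha> ` elts \<beta>)"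
proof -
  have "oadd \<alpha> \<beta> = vset (elts \<alpha> \<union> cut (oadd \<alpha>) memrel \<beta> ` elts \<beta>)"
    by (simp add: oadd_def wfrec[OF wf_memrel, of _ \<beta>])
  also have "cut (oadd \<alpha>) memrel \<beta> ` elts \<beta> = oadd \<alpha> ` elts \<beta>"
    by (intro image_cong) (auto simp: cut_apply)
  finally show ?thesis .
qed

lemma omul_rec: "omul \<alpha> \<beta> = vset (\<Union>\<gamma>\<in>elts \<beta>. elts (oadd (omul \<alpha> \<gamma>) \<alpha>))"
proof -
  have "omul \<alpha> \<beta> = vset (\<Union>\<gamma>\<in>elts \<beta>. elts (oadd (cut (omul \<alpha>) memrel \<beta> \<gamma>) \<alpha>))"
    by (simp add: omul_def wfrec[OF wf_memrel, of _ \<beta>])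
  also have "(\<Union>\<gamma>\<in>elts \<beta>. elts (oadd (cut (omul \<alpha>) memrel \<beta> \<gamma>) \<alpha>))
      = (\<Union>\<gamma>\<in>elts \<beta>. elts (oadd (omul \<alpha> \<gamma>) \<alpha>))"
    by (intro SUP_cong) (auto simp: cut_apply)
  finally show ?thesis .
qed

lemma omega_pow_rec:
  "omega_pow \<beta> = vset (elts (ord_of_nat 1) \<union> (\<Union>\<gamma>\<in>elts \<beta>. elts (omul (omega_pow \<gamma>) omega)))"
proof -
  have "omega_pow \<beta> = vset (elts (ord_of_nat 1) \<union>
      (\<Union>\<gamma>\<in>elts \<beta>. elts (omul (cut omega_pow memrel \<beta> \<gamma>) omega)))"
    by (simp add: omega_pow_def wfrec[OF wf_memrel, of _ \<beta>])
  also have "(\<Union>\<gamma>\<in>elts \<beta>. elts (omul (cut omega_pow memrel \<beta> \<gamma>) omega))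
      = (\<Union>\<gamma>\<in>elts \<beta>. elts (omul (omega_pow \<gamma>) omega))"
    by (intro SUP_cong) (auto simp: cut_apply)
  finally show ?thesis .
qed


subsection \<open>Cantor normal form and natural operations\<close>

text \<open>A Cantor normal form is given by its coefficient function, finitely supported on the
  ordinals.  Its value is \<open>\<omega>^\<zeta>\<^sub>1 c\<^sub>1 + \<dots> + \<omega>^\<zeta>\<^sub>k c\<^sub>k\<close>, where
  \<open>\<zeta>\<^sub>1 > \<dots> > \<zeta>\<^sub>k\<close> enumerates the support.\<close>

definition supp :: "('v \<Rightarrow> 'c::zero) \<Rightarrow> 'v set"
  where "supp c = {\<zeta>. c \<zeta> \<noteq> 0}"

definition descending_list :: "'v set \<Rightarrow> 'v list"
  where "descending_list S = (THE zs. sorted_wrt (\<lambda>x y. olt y x) zs \<and> set zs = S)"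

definition cnf_val :: "('v \<Rightarrow> nat) \<Rightarrow> 'v"
  where "cnf_val c = foldr (\<lambda>\<zeta> s. oadd (omul (omega_pow \<zeta>) (ord_of_nat (c \<zeta>))) s)
    (descending_list (supp c)) (ord_of_nat 0)"

definition cnf :: "'v \<Rightarrow> 'v \<Rightarrow> nat"
  where "cnf \<alpha> = (THE c. finite (supp c) \<and> (\<forall>\<zeta>\<in>supp c. Ord \<zeta>) \<and> cnf_val c = \<alpha>)"

definition nadd :: "'v \<Rightarrow> 'v \<Rightarrow> 'v"
  where "nadd \<alpha> \<beta> = cnf_val (\<lambda>\<zeta>. cnf \<alpha> \<zeta> + cnf \<beta> \<zeta>)"

text \<open>Polynomial-style product of coefficient functions, exponents being added by the natural
  sum.\<close>

definition conv :: "('v \<Rightarrow> 'c) \<Rightarrow> ('v \<Rightarrow> 'c) \<Rightarrow> 'v \<Rightarrow> 'c::comm_semiring_0"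
  where "conv c d \<zeta> = (\<Sum>(\<xi>, \<eta>) \<in> {(\<xi>, \<eta>) \<in> supp c \<times> supp d. nadd \<xi> \<eta> = \<zeta>}. c \<xi> * d \<eta>)"

definition nmul :: "'v \<Rightarrow> 'v \<Rightarrow> 'v"
  where "nmul \<alpha> \<beta> = cnf_val (conv (cnf \<alpha>) (cnf \<beta>))"

definition transfinite_times_number :: "'v \<Rightarrow> bool"
  where "transfinite_times_number l \<longleftrightarrow> Ord l \<and> ole omega l \<and>
    (\<forall>\<beta> \<gamma>. olt \<beta> l \<longrightarrow> olt \<gamma> l \<longrightarrow> olt (nmul \<beta> \<gamma>) l)"


subsection \<open>Surintegers\<close>

definition Z_inf :: "'v set"
  where "Z_inf = {kpair \<alpha> \<beta> | \<alpha> \<beta>. Ord \<alpha> \<and> Ord \<beta> \<and> supp (cnf \<alpha>) \<inter> supp (cnf \<beta>) = {}}"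

definition Z_below :: "'v \<Rightarrow> 'v set"
  where "Z_below l = {z \<in> Z_inf. olt (vfst z) l \<and> olt (vsnd z) l}"

text \<open>The pair \<open>(\<alpha>, \<beta>)\<close> stands for \<open>\<alpha> - \<beta>\<close>, that is, for the finite sum of the
  \<open>\<omega>^\<zeta> c\<^sub>\<zeta>\<close> whose positive coefficients are those of \<open>\<alpha>\<close> and whose negative ones are
  those of \<open>\<beta>\<close>.\<close>

definition zcoeff :: "'v \<Rightarrow> 'v \<Rightarrow> int"
  where "zcoeff z \<zeta> = int (cnf (vfst z) \<zeta>) - int (cnf (vsnd z) \<zeta>)"

definition z_of_coeff :: "('v \<Rightarrow> int) \<Rightarrow> 'v"
  where "z_of_coeff c = kpair (cnf_val (\<lambda>\<zeta>. nat (c \<zeta>))) (cnf_val (\<lambda>\<zeta>. nat (- c \<zeta>)))"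

definition zzero :: 'v
  where "zzero = kpair (ord_of_nat 0) (ord_of_nat 0)"

definition zone :: 'v
  where "zone = kpair (ord_of_nat 1) (ord_of_nat 0)"

definition zneg :: "'v \<Rightarrow> 'v"
  where "zneg z = z_of_coeff (\<lambda>\<zeta>. - zcoeff z \<zeta>)"

definition zmul :: "'v \<Rightarrow> 'v \<Rightarrow> 'v"
  where "zmul z w = z_of_coeff (conv (zcoeff z) (zcoeff w))"

text \<open>\<open>\<alpha> - \<beta> \<le> \<gamma> - \<delta>\<close> iff \<open>\<alpha> \<oplus> \<delta> \<le> \<gamma> \<oplus> \<beta>\<close>.\<close>

definition zle :: "'v \<Rightarrow> 'v \<Rightarrow> bool"
  where "zle z w \<longleftrightarrow> ole (nadd (vfst z) (vsnd w)) (nadd (vfst w) (vsnd z))"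

definition zdvd :: "'v \<Rightarrow> 'v \<Rightarrow> bool"
  where "zdvd d z \<longleftrightarrow> (\<exists>e\<in>Z_inf. z = zmul d e)"


subsection \<open>Fractions and cuts\<close>

definition Q_inf :: "'v set"
  where "Q_inf = {kpair a b | a b. a \<in> Z_inf \<and> b \<in> Z_inf \<and> zle zzero b \<and> b \<noteq> zzero \<and>
    (\<forall>d\<in>Z_inf. zdvd d a \<and> zdvd d b \<longrightarrow> d = zone \<or> d = zneg zone)}"

definition qle :: "'v \<Rightarrow> 'v \<Rightarrow> bool"
  where "qle p q \<longleftrightarrow> zle (zmul (vfst p) (vsnd q)) (zmul (vsnd p) (vfst q))"

definition qlt :: "'v \<Rightarrow> 'v \<Rightarrow> bool"
  where "qlt p q \<longleftrightarrow> qle p q \<and> p \<noteq> q"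

definition Q_below :: "'v \<Rightarrow> 'v set"
  where "Q_below l = {q \<in> Q_inf. vfst q \<in> Z_below l \<and> vsnd q \<in> Z_below l}"

text \<open>The empty set is a cut; only the whole of \<open>Q_below l\<close> is excluded.\<close>

definition is_cut :: "'v \<Rightarrow> 'v \<Rightarrow> bool"
  where "is_cut l L \<longleftrightarrow> elts L \<subset> Q_below l \<and>
    \<not> (\<exists>m\<in>elts L. \<forall>x\<in>elts L. qle x m) \<and>
    (\<forall>x\<in>elts L. \<forall>y\<in>Q_below l - elts L. qlt x y)"

definition R_below :: "'v \<Rightarrow> 'v set"
  where "R_below l = {L. is_cut l L}"

definition R_inf :: "'v set"
  where "R_inf = (\<Union>l \<in> {l. transfinite_times_number l}. R_below l)"

end

end

(* For a suitably closed transfinite times-number l, the negative fractions of Q_l form a cut: it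
   lacks the fraction 0, and a/b < 0 lies below -1/omega^eta as soon as eta exceeds all exponents of b.
   This cut contains (-alpha, 1) for every nonzero alpha < l, so the union of all cuts involves
   every nonzero ordinal.  Only sign rules for surintegers are needed, and these follow from leading
   terms, since natural addition of exponents is strictly monotone. *)

theory Submission
  imports Defs
begin

text \<open>A set of cuts would, by union and replacement, yield a set containing every ordinal; so
  each nonzero \<open>\<alpha>\<close> needs just one \<open>l\<close>, and times-numbers need no
  classification. This \<open>l\<close> is the closure of max(\<open>\<alpha>\<close> + 1,
  \<open>\<omega>\<close>) under natural product and under sending \<open>\<beta>\<close> to
  \<open>\<omega>\<close> to the power \<open>\<beta>\<close> + 1. The second closure leaves room
  for the denominator of -1/\<open>\<omega>\<close>^\<open>\<eta>\<close>: \<open>\<eta>\<close> is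
  taken above the coordinates of b themselves, which bound its exponents crudely.

  The obstacle is that all operations go through the definite descriptions \<open>cnf\<close> and
  \<open>descending_list\<close>, so existence and uniqueness of Cantor normal forms come before any
  computation. Afterwards every comparison becomes the sign of the leading coefficient of an
  integer-valued function, and products enter only through leading terms and sign changes.
  Coprimality could have required a divisibility theory; every fraction exhibited therefore has 1 or
  -1 as numerator or denominator.\<close>

context morse_kelley
begin

lemma not_mem_self: "x \<notin> elts x"
  using regularity[of "{x}"] by auto

lemma mem_asym: "x \<in> elts y \<Longrightarrow> y \<notin> elts x"
  using regularity[of "{x, y}"] by auto


subsection \<open>Sets among classes\<close>

lemma is_set_elts [simp, intro]: "is_set (elts x)"
  by (auto simp: is_set_def)

lemma is_set_mono: "X \<subseteq> Y \<Longrightarrow> is_set Y \<Longrightarrow> is_set X"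
  using subsets by (auto simp: is_set_def)

lemma is_set_image: "is_set X \<Longrightarrow> is_set (f ` X)"
  using replacement by (auto simp: is_set_def)

lemma is_set_pair: "is_set {x, y}"
  using pairing by (auto simp: is_set_def)

lemma is_set_singleton: "is_set {x}"
  using is_set_pair[of x x] by simp

lemma is_set_empty: "is_set {}"
  by (rule is_set_mono[OF _ is_set_singleton]) auto

lemma elts_vset:
  assumes "is_set X"
  shows "elts (vset X) = X"
proof -
  from assms obtain x where x: "elts x = X" by (auto simp: is_set_def)
  then have "vset X = x"
    unfolding vset_def by (intro the_equality) (auto intro: extensionality)
  with x show ?thesis by simp
qed

text \<open>A family of classes cannot be collected directly. Its members are coded by
  \<open>vset\<close>, replacement collects the codes, and the union axiom merges them.\<close>

lemma is_set_UN:
  assumes "is_set X" and "\<And>x. x \<in> X \<Longrightarrow> is_set (F x)"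
  shows "is_set (\<Union>x\<in>X. F x)"
proof -
  from is_set_image[OF assms(1), of "\<lambda>x. vset (F x)"] obtain y
    where y: "elts y = (\<lambda>x. vset (F x)) ` X" by (auto simp: is_set_def)
  have "(\<Union>z\<in>elts y. elts z) = (\<Union>x\<in>X. F x)"
    using assms(2) by (auto simp: y elts_vset)
  then show ?thesis using union[of y] by (auto simp: is_set_def)
qed

lemma is_set_Un:
  assumes "is_set X" "is_set Y"
  shows "is_set (X \<union> Y)"
proof -
  have "is_set (\<Union>z\<in>{vset X, vset Y}. elts z)"
    by (intro is_set_UN is_set_pair is_set_elts)
  then show ?thesis by (simp add: elts_vset assms)
qed

lemma is_set_insert: "is_set X \<Longrightarrow> is_set (insert x X)"
  using is_set_Un[OF is_set_singleton[of x]] by simp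

lemma kpair_inject: "kpair a b = kpair c d \<longleftrightarrow> a = c \<and> b = d"
proof
  assume eq: "kpair a b = kpair c d"
  have vs: "vset X = vset Y \<longleftrightarrow> X = Y" if "is_set X" "is_set Y" for X Y
    using elts_vset that by metis
  from eq have "{vset {a}, vset {a, b}} = {vset {c}, vset {c, d}}"
    by (simp add: kpair_def vs is_set_pair)
  then show "a = c \<and> b = d"
    using vs[OF is_set_pair is_set_pair] vs[OF is_set_singleton is_set_pair]
      vs[OF is_set_pair is_set_singleton] vs[OF is_set_singleton is_set_singleton]
    by (auto simp: doubleton_eq_iff)
qed auto

lemma vfst_kpair [simp]: "vfst (kpair a b) = a"
  by (auto simp: vfst_def kpair_inject)

lemma vsnd_kpair [simp]: "vsnd (kpair a b) = b"
  by (auto simp: vsnd_def kpair_inject)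

lemma is_set_kpairs:
  assumes "is_set A" "is_set B"
  shows "is_set {kpair a b | a b. a \<in> A \<and> b \<in> B}"
proof -
  have "is_set (\<Union>a\<in>A. kpair a ` B)"
    by (intro is_set_UN is_set_image assms)
  then show ?thesis by (rule is_set_mono[rotated]) auto
qed


subsection \<open>Ordinals\<close>

lemma Ord_trans: "Ord \<alpha> \<Longrightarrow> \<beta> \<in> elts \<alpha> \<Longrightarrow> \<gamma> \<in> elts \<beta> \<Longrightarrow> \<gamma> \<in> elts \<alpha>"
  unfolding Ord_def by blast

lemma Ord_elem:
  assumes "Ord \<alpha>" "\<beta> \<in> elts \<alpha>"
  shows "Ord \<beta>"
  unfolding Ord_def
proof (intro conjI ballI subsetI)
  fix x y assume x: "x \<in> elts \<beta>" and y: "y \<in> elts x"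
  have xa: "x \<in> elts \<alpha>" and ya: "y \<in> elts \<alpha>" using assms x y Ord_trans by blast+
  have "y \<in> elts \<beta> \<or> y = \<beta> \<or> \<beta> \<in> elts y"
    using assms ya unfolding Ord_def by blast
  moreover have "y \<noteq> \<beta>" using x y mem_asym by blast
  moreover have "\<beta> \<notin> elts y"
    \<comment> \<open>Regularity rules out a membership cycle of length three.\<close>
    using regularity[of "{x, y, \<beta>}"] x y by auto
  ultimately show "y \<in> elts \<beta>" by blast
next
  fix x y assume "x \<in> elts \<beta>" "y \<in> elts \<beta>"
  then show "x \<in> elts y \<or> x = y \<or> y \<in> elts x"
    using assms unfolding Ord_def by blast
qed

text \<open>A membership-minimal element of the difference has exactly the members of
  \<open>\<alpha>\<close>, hence is \<open>\<alpha>\<close>.\<close>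

lemma Ord_psubset_mem:
  assumes "Ord \<alpha>" "Ord \<beta>" "elts \<alpha> \<subseteq> elts \<beta>" "\<alpha> \<noteq> \<beta>"
  shows "\<alpha> \<in> elts \<beta>"
proof -
  have "elts \<beta> - elts \<alpha> \<noteq> {}" using assms extensionality by blast
  from regularity[OF this] obtain x where x: "x \<in> elts \<beta>" "x \<notin> elts \<alpha>"
    and sub: "elts x \<inter> (elts \<beta> - elts \<alpha>) = {}" by blast
  have "elts x \<subseteq> elts \<alpha>" using sub Ord_trans[OF assms(2) x(1)] by blast
  moreover have "y \<in> elts x" if "y \<in> elts \<alpha>" for y
  proof -
    have "x \<in> elts y \<or> x = y \<or> y \<in> elts x"
      using assms that x unfolding Ord_def by blast
    then show ?thesis using that x Ord_trans[OF assms(1) that] by blast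
  qed
  ultimately have "x = \<alpha>" by (intro extensionality) auto
  with x show ?thesis by simp
qed

text \<open>The intersection is an ordinal; if it differed from both, it would belong to both and so
  to itself.\<close>

lemma Ord_linear:
  assumes "Ord \<alpha>" "Ord \<beta>"
  shows "\<alpha> \<in> elts \<beta> \<or> \<alpha> = \<beta> \<or> \<beta> \<in> elts \<alpha>"
proof -
  have I: "is_set (elts \<alpha> \<inter> elts \<beta>)" by (rule is_set_mono[of _ "elts \<alpha>"]) auto
  define \<mu> where "\<mu> = vset (elts \<alpha> \<inter> elts \<beta>)"
  have e: "elts \<mu> = elts \<alpha> \<inter> elts \<beta>" by (simp add: \<mu>_def elts_vset I)
  have "Ord \<mu>" using assms by (auto simp: Ord_def e)
  then have "\<mu> = \<alpha> \<or> \<mu> \<in> elts \<alpha>" "\<mu> = \<beta> \<or> \<mu> \<in> elts \<beta>"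
    using Ord_psubset_mem assms e by blast+
  then show ?thesis using e not_mem_self[of \<mu>] by blast
qed

lemma Ord_subset_iff:
  assumes "Ord \<alpha>" "Ord \<beta>"
  shows "elts \<alpha> \<subseteq> elts \<beta> \<longleftrightarrow> \<alpha> \<in> elts \<beta> \<or> \<alpha> = \<beta>"
  using assms Ord_psubset_mem Ord_trans by blast

lemma Ord_ole_total: "Ord \<alpha> \<Longrightarrow> Ord \<beta> \<Longrightarrow> ole \<alpha> \<beta> \<longleftrightarrow> \<not> olt \<beta> \<alpha>"
  using Ord_linear not_mem_self mem_asym unfolding ole_def olt_def by blast

lemma Ord_le_less_trans:
  assumes "Ord \<alpha>" "Ord \<gamma>" "elts \<alpha> \<subseteq> elts \<beta>" "\<beta> \<in> elts \<gamma>"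
  shows "\<alpha> \<in> elts \<gamma>"
  using assms(3,4) Ord_subset_iff[OF assms(1) Ord_elem[OF assms(2,4)]]
    Ord_trans[OF assms(2,4)] by blast

text \<open>The usual way to establish \<open>Ord\<close> below: for members that are ordinals,
  trichotomy comes from \<open>Ord_linear\<close>.\<close>

lemma Ord_transitive_class:
  assumes "\<And>x. x \<in> elts \<alpha> \<Longrightarrow> Ord x" "\<And>x y. x \<in> elts \<alpha> \<Longrightarrow> y \<in> elts x \<Longrightarrow> y \<in> elts \<alpha>"
  shows "Ord \<alpha>"
  unfolding Ord_def using assms(2) Ord_linear[OF assms(1) assms(1)] by blast

text \<open>Burali-Forti: a set of all ordinals would be an ordinal and hence its own
  member.\<close>

lemma proper_class_Ord: "\<not> is_set {\<alpha>. Ord \<alpha>}"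
proof
  assume "is_set {\<alpha>. Ord \<alpha>}"
  then obtain x where x: "elts x = {\<alpha>. Ord \<alpha>}" by (auto simp: is_set_def)
  have "Ord x" by (rule Ord_transitive_class) (use x Ord_elem in auto)
  then show False using x not_mem_self by blast
qed

lemma Ord_UN:
  assumes "is_set X" "\<And>x. x \<in> X \<Longrightarrow> Ord (f x)"
  shows "Ord (vset (\<Union>x\<in>X. elts (f x)))"
proof -
  have "elts (vset (\<Union>x\<in>X. elts (f x))) = (\<Union>x\<in>X. elts (f x))"
    by (intro elts_vset is_set_UN assms is_set_elts)
  then show ?thesis
    by - (rule Ord_transitive_class, auto dest: Ord_elem[OF assms(2)] Ord_trans[OF assms(2)])
qed

lemma Ord_Un:
  assumes "Ord \<alpha>" "Ord \<beta>"
  shows "Ord (vset (elts \<alpha> \<union> elts \<beta>))"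
  using Ord_UN[OF is_set_pair, of \<alpha> \<beta> id] assms by auto

section \<open>Successors, finite ordinals, \<open>\<omega>\<close>, and closure ordinals\<close>

definition osucc :: "'v \<Rightarrow> 'v"
  where "osucc \<alpha> = vset (insert \<alpha> (elts \<alpha>))"

lemma elts_osucc [simp]: "elts (osucc \<alpha>) = insert \<alpha> (elts \<alpha>)"
  by (simp add: osucc_def elts_vset is_set_insert)

lemma Ord_osucc: "Ord \<alpha> \<Longrightarrow> Ord (osucc \<alpha>)"
  by (rule Ord_transitive_class) (auto dest: Ord_elem Ord_trans)

abbreviation ozero :: 'v
  where "ozero \<equiv> ord_of_nat 0"

lemma elts_vset_empty [simp]: "elts (vset {}) = {}"
  by (simp add: elts_vset is_set_empty)

lemma ord_of_nat_Suc_osucc: "ord_of_nat (Suc n) = osucc (ord_of_nat n)"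
  by (simp add: osucc_def)

lemma Ord_ord_of_nat: "Ord (ord_of_nat n)"
proof (induction n)
  case 0
  show ?case by (rule Ord_transitive_class) auto
qed (simp add: ord_of_nat_Suc_osucc Ord_osucc del: ord_of_nat.simps)

lemma elts_ord_of_nat: "elts (ord_of_nat n) = ord_of_nat ` {..<n}"
  by (induction n)
    (simp_all add: ord_of_nat_Suc_osucc lessThan_Suc del: ord_of_nat.simps(2))

lemma inj_ord_of_nat: "inj ord_of_nat"
proof (rule injI)
  fix m n assume eq: "ord_of_nat m = ord_of_nat n"
  have "ord_of_nat i \<noteq> ord_of_nat j" if "i < j" for i j
    using that elts_ord_of_nat[of j] not_mem_self[of "ord_of_nat j"]
    by (metis imageI lessThan_iff)
  with eq show "m = n" by (cases m n rule: linorder_cases) metis+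
qed

lemma is_set_range_ord_of_nat: "is_set (range ord_of_nat)"
proof -
  obtain z e where e: "e \<in> elts z" "elts e = {}"
    and s: "\<And>x. x \<in> elts z \<Longrightarrow> \<exists>s\<in>elts z. elts s = insert x (elts x)"
    using infinity by metis
  have "ord_of_nat n \<in> elts z" for n
  proof (induction n)
    case 0
    have "ord_of_nat 0 = e" by (rule extensionality) (simp add: e)
    with e show ?case by simp
  next
    case (Suc n)
    from s[OF Suc] obtain t where t: "t \<in> elts z" "elts t = elts (ord_of_nat (Suc n))"
      unfolding ord_of_nat_Suc_osucc by auto
    from extensionality[OF t(2)] t(1) show ?case by simp
  qed
  then show ?thesis by (intro is_set_mono[OF _ is_set_elts]) auto
qed

lemma elts_omega: "elts omega = range ord_of_nat"
  by (simp add: omega_def elts_vset is_set_range_ord_of_nat)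

lemma Ord_omega: "Ord omega"
  by (rule Ord_transitive_class) (auto simp: elts_omega elts_ord_of_nat Ord_ord_of_nat)

text \<open>Replacement needs a set as domain, so a sequence over the HOL naturals is re-indexed
  along \<open>omega\<close>.\<close>

lemma is_set_range_nat: "is_set (range (f :: nat \<Rightarrow> 'v))"
proof -
  have "range f = (f \<circ> inv ord_of_nat) ` elts omega"
    by (auto simp: elts_omega image_image inv_f_f[OF inj_ord_of_nat])
  then show ?thesis by (simp add: is_set_image)
qed

text \<open>Iterate \<open>\<omega>\<close> times the step that adjoins all values of
  \<open>F\<close> on the current ordinal, and take the supremum. No monotonicity of
  \<open>F\<close> is involved.\<close>

lemma exists_closed_ordinal:
  assumes "Ord \<alpha>" and F: "\<And>\<beta> \<gamma>. Ord \<beta> \<Longrightarrow> Ord \<gamma> \<Longrightarrow> Ord (F \<beta> \<gamma>)"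
  obtains l where "Ord l" "elts \<alpha> \<subseteq> elts l"
    "\<And>\<beta> \<gamma>. \<beta> \<in> elts l \<Longrightarrow> \<gamma> \<in> elts l \<Longrightarrow> F \<beta> \<gamma> \<in> elts l"
proof -
  \<comment> \<open>\<open>osucc\<close> makes each value a member of the next stage rather than
    merely a subset. The inner \<open>vset\<close> makes the nested union a supremum of ordinals, so
    that \<open>Ord_UN\<close> applies twice.\<close>
  define G where "G \<delta> = vset (\<Union>\<beta>\<in>elts \<delta>. elts (vset (\<Union>\<gamma>\<in>elts \<delta>. elts (osucc (F \<beta> \<gamma>)))))" for \<delta>
  define S where "S \<delta> = vset (elts \<delta> \<union> elts (G \<delta>))" for \<delta>
  have elts_S: "elts (S \<delta>) = elts \<delta> \<union> elts (G \<delta>)" for \<delta>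
    by (simp add: S_def elts_vset is_set_Un)
  have elts_G: "elts (G \<delta>) = (\<Union>\<beta>\<in>elts \<delta>. \<Union>\<gamma>\<in>elts \<delta>. elts (osucc (F \<beta> \<gamma>)))" for \<delta>
    unfolding G_def by (subst elts_vset; intro is_set_UN is_set_elts SUP_cong refl elts_vset)
  have Ord_G: "Ord (G \<delta>)" if "Ord \<delta>" for \<delta>
    unfolding G_def by (intro Ord_UN Ord_osucc F is_set_elts; rule Ord_elem[OF that])
  have Ord_S: "Ord (S \<delta>)" if "Ord \<delta>" for \<delta>
    unfolding S_def by (intro Ord_Un that Ord_G)
  define s where "s n = (S ^^ n) \<alpha>" for n
  have s_Suc: "s (Suc n) = S (s n)" and s0: "s 0 = \<alpha>" for n by (auto simp: s_def)
  have Ord_s: "Ord (s n)" for n by (induction n) (auto simp: s_Suc s0 Ord_S assms)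
  have mono: "elts (s m) \<subseteq> elts (s n)" if "m \<le> n" for m n
    using that by (rule lift_Suc_mono_le[rotated]) (auto simp: s_Suc elts_S)
  define l where "l = vset (\<Union>x\<in>range s. elts x)"
  have l: "elts l = (\<Union>n. elts (s n))"
    unfolding l_def
    by (subst elts_vset, rule is_set_UN[OF is_set_range_nat is_set_elts]) simp
  have "Ord l" unfolding l_def by (rule Ord_UN) (auto simp: is_set_range_nat Ord_s)
  moreover have "elts \<alpha> \<subseteq> elts l" using s0 by (auto simp: l)
  \<comment> \<open>Both arguments already occur at the later of their two stages, so the value
    appears one stage after it.\<close>
  moreover have "F \<beta> \<gamma> \<in> elts l" if "\<beta> \<in> elts l" "\<gamma> \<in> elts l" for \<beta> \<gamma>
  proof -
    from that obtain m n where "\<beta> \<in> elts (s m)" "\<gamma> \<in> elts (s n)" by (auto simp: l)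
    with mono[of m "max m n"] mono[of n "max m n"]
    have "\<beta> \<in> elts (s (max m n))" "\<gamma> \<in> elts (s (max m n))" by auto
    then have "F \<beta> \<gamma> \<in> elts (s (Suc (max m n)))"
      unfolding s_Suc elts_S elts_G by auto
    then show ?thesis unfolding l by blast
  qed
  ultimately show ?thesis by (rule that)
qed


subsection \<open>Ordinal arithmetic\<close>

lemma elts_oadd: "elts (oadd \<alpha> \<beta>) = elts \<alpha> \<union> oadd \<alpha> ` elts \<beta>"
  by (subst oadd_rec) (simp add: elts_vset is_set_Un is_set_image)

lemma oadd_zero_right [simp]: "oadd \<alpha> (vset {}) = \<alpha>"
  by (rule extensionality) (simp add: elts_oadd)

lemma oadd_zero_left [simp]: "oadd (vset {}) \<alpha> = \<alpha>"
proof (induction \<alpha> rule: wf_induct_rule[OF wf_memrel])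
  case (1 \<alpha>)
  then show ?case by (intro extensionality) (auto simp: elts_oadd)
qed

lemma Ord_oadd: "Ord \<alpha> \<Longrightarrow> Ord \<beta> \<Longrightarrow> Ord (oadd \<alpha> \<beta>)"
proof (induction \<beta> rule: wf_induct_rule[OF wf_memrel])
  case (1 \<beta>)
  have IH: "Ord (oadd \<alpha> \<gamma>)" if "\<gamma> \<in> elts \<beta>" for \<gamma>
    using 1(1)[of \<gamma>] 1(2) Ord_elem[OF 1(3) that] that by simp
  show ?case
  proof (rule Ord_transitive_class)
    fix x y assume x: "x \<in> elts (oadd \<alpha> \<beta>)"
    show "Ord x" using x IH Ord_elem[OF 1(2)] by (auto simp: elts_oadd)
    assume "y \<in> elts x"
    with x show "y \<in> elts (oadd \<alpha> \<beta>)"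
      using Ord_trans[OF 1(2)] Ord_trans[OF 1(3)] by (auto simp: elts_oadd)
  qed
qed

lemma oadd_mono_left:
  assumes "Ord \<alpha>" "Ord \<alpha>'" "Ord \<beta>" "elts \<alpha> \<subseteq> elts \<alpha>'"
  shows "elts (oadd \<alpha> \<beta>) \<subseteq> elts (oadd \<alpha>' \<beta>)"
  using assms(3)
proof (induction \<beta> rule: wf_induct_rule[OF wf_memrel])
  case (1 \<beta>)
  have "oadd \<alpha> \<gamma> \<in> elts (oadd \<alpha>' \<beta>)" if g: "\<gamma> \<in> elts \<beta>" for \<gamma>
  proof (rule Ord_le_less_trans)
    have "Ord \<gamma>" by (rule Ord_elem[OF 1(2) g])
    then show "elts (oadd \<alpha> \<gamma>) \<subseteq> elts (oadd \<alpha>' \<gamma>)" "Ord (oadd \<alpha> \<gamma>)"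
      using 1(1)[of \<gamma>] g Ord_oadd[OF assms(1)] by simp_all
    show "Ord (oadd \<alpha>' \<beta>)" by (rule Ord_oadd[OF assms(2) 1(2)])
    show "oadd \<alpha>' \<gamma> \<in> elts (oadd \<alpha>' \<beta>)" using g by (auto simp: elts_oadd)
  qed
  then show ?case using assms(4) by (auto simp: elts_oadd[of \<alpha>] elts_oadd[of \<alpha>'])
qed

lemma elts_omul: "elts (omul \<alpha> \<beta>) = (\<Union>\<gamma>\<in>elts \<beta>. elts (oadd (omul \<alpha> \<gamma>) \<alpha>))"
  by (subst omul_rec) (simp add: elts_vset is_set_UN)

lemma Ord_omul: "Ord \<alpha> \<Longrightarrow> Ord \<beta> \<Longrightarrow> Ord (omul \<alpha> \<beta>)"
proof (induction \<beta> rule: wf_induct_rule[OF wf_memrel])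
  case (1 \<beta>)
  then show ?case
    unfolding omul_rec[of _ \<beta>] by (intro Ord_UN Ord_oadd is_set_elts) (auto dest: Ord_elem)
qed

lemma omul_mono: "elts \<beta> \<subseteq> elts \<gamma> \<Longrightarrow> elts (omul \<alpha> \<beta>) \<subseteq> elts (omul \<alpha> \<gamma>)"
  by (auto simp: elts_omul)

lemma omul_zero [simp]: "omul \<alpha> (vset {}) = vset {}"
  by (rule extensionality) (simp add: elts_omul)

text \<open>The union in the recursion increases with its index, by left monotonicity of addition,
  so the last index absorbs all others.\<close>

lemma omul_osucc:
  assumes "Ord \<alpha>" "Ord \<beta>"
  shows "omul \<alpha> (osucc \<beta>) = oadd (omul \<alpha> \<beta>) \<alpha>"
proof (rule extensionality)
  have "elts (oadd (omul \<alpha> \<gamma>) \<alpha>) \<subseteq> elts (oadd (omul \<alpha> \<beta>) \<alpha>)" if "\<gamma> \<in> elts \<beta>" for \<gamma>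
    using Ord_elem[OF assms(2) that] Ord_trans[OF assms(2) that] assms
    by (intro oadd_mono_left Ord_omul omul_mono) auto
  then show "elts (omul \<alpha> (osucc \<beta>)) = elts (oadd (omul \<alpha> \<beta>) \<alpha>)"
    by (auto simp: elts_omul[of _ "osucc \<beta>"])
qed

lemma omul_Suc:
  "Ord \<alpha> \<Longrightarrow> omul \<alpha> (ord_of_nat (Suc n)) = oadd (omul \<alpha> (ord_of_nat n)) \<alpha>"
  by (simp add: ord_of_nat_Suc_osucc omul_osucc Ord_ord_of_nat del: ord_of_nat.simps)

lemma omul_one: "Ord \<alpha> \<Longrightarrow> omul \<alpha> (ord_of_nat 1) = \<alpha>"
  using omul_Suc[of \<alpha> 0] by simp

lemma elts_omega_pow:
  "elts (omega_pow \<beta>) = insert ozero (\<Union>\<gamma>\<in>elts \<beta>. elts (omul (omega_pow \<gamma>) omega))"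
  by (subst omega_pow_rec)
    (simp add: elts_vset is_set_UN is_set_insert is_set_empty)

lemma Ord_omega_pow: "Ord \<beta> \<Longrightarrow> Ord (omega_pow \<beta>)"
proof (induction \<beta> rule: wf_induct_rule[OF wf_memrel])
  case (1 \<beta>)
  let ?X = "\<Union>\<gamma>\<in>elts \<beta>. elts (omul (omega_pow \<gamma>) omega)"
  have "Ord (vset ?X)"
  proof (rule Ord_UN)
    fix \<gamma> assume "\<gamma> \<in> elts \<beta>"
    then show "Ord (omul (omega_pow \<gamma>) omega)"
      using 1(1)[of \<gamma>] Ord_elem[OF 1(2)] by (simp add: Ord_omul Ord_omega)
  qed simp
  moreover have "elts (vset ?X) = ?X" by (simp add: elts_vset is_set_UN)
  ultimately show ?case
    using Ord_Un[OF Ord_ord_of_nat[of 1], of "vset ?X"] omega_pow_rec[of \<beta>] by simp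
qed

text \<open>The recursion at \<open>omega\<close> produces only the multiples by n + 1; the multiple
  by 0 is empty and adds nothing.\<close>

lemma mem_omul_omega:
  assumes "Ord \<alpha>"
  shows "x \<in> elts (omul \<alpha> omega) \<longleftrightarrow> (\<exists>n. x \<in> elts (omul \<alpha> (ord_of_nat n)))"
proof -
  have "x \<in> elts (omul \<alpha> omega) \<longleftrightarrow> (\<exists>n. x \<in> elts (omul \<alpha> (ord_of_nat (Suc n))))"
    by (simp only: elts_omul[of _ omega] elts_omega omul_Suc[OF assms]) auto
  also have "\<dots> \<longleftrightarrow> (\<exists>n. x \<in> elts (omul \<alpha> (ord_of_nat n)))"
  proof
    assume "\<exists>n. x \<in> elts (omul \<alpha> (ord_of_nat n))"
    then obtain n where "x \<in> elts (omul \<alpha> (ord_of_nat n))" ..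
    then show "\<exists>n. x \<in> elts (omul \<alpha> (ord_of_nat (Suc n)))" by (cases n) auto
  qed blast
  finally show ?thesis .
qed

lemma omega_pow_less_term:
  assumes "Ord \<zeta>" "\<xi> \<in> elts \<zeta>"
  shows "elts (omul (omega_pow \<xi>) (ord_of_nat n)) \<subseteq> elts (omega_pow \<zeta>)"
proof -
  have "Ord \<xi>" using assms Ord_elem by blast
  then show ?thesis
    unfolding elts_omega_pow[of \<zeta>] using assms mem_omul_omega[OF Ord_omega_pow] by blast
qed

text \<open>A remainder below the power never carries into the next multiple. All estimates of
  normal forms rest on this.\<close>

lemma term_plus_rest_less:
  assumes "Ord \<xi>" "\<rho> \<in> elts (omega_pow \<xi>)"
  shows "oadd (omul (omega_pow \<xi>) (ord_of_nat n)) \<rho> \<in> elts (omul (omega_pow \<xi>) (ord_of_nat (Suc n)))"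
  unfolding omul_Suc[OF Ord_omega_pow[OF assms(1)]] using assms(2) by (auto simp: elts_oadd)

text \<open>Places every ordinal below some power of \<open>\<omega>\<close>, where
  \<open>cnf_exists\<close> applies. The induction first gives \<open>\<alpha>\<close> \<le>
  \<open>\<omega>\<close>^\<open>\<alpha>\<close>; one more exponent makes it strict.\<close>

lemma mem_omega_pow_osucc: "Ord \<alpha> \<Longrightarrow> \<alpha> \<in> elts (omega_pow (osucc \<alpha>))"
proof (induction \<alpha> rule: wf_induct_rule[OF wf_memrel])
  case (1 \<alpha>)
  have sub: "elts (omega_pow (osucc \<beta>)) \<subseteq> elts (omega_pow \<alpha>)" if "\<beta> \<in> elts \<alpha>" for \<beta>
    using that Ord_trans[OF 1(2)] by (auto simp: elts_omega_pow)
  have le: "elts \<alpha> \<subseteq> elts (omega_pow \<alpha>)"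
  proof
    fix \<beta> assume b: "\<beta> \<in> elts \<alpha>"
    then have "\<beta> \<in> elts (omega_pow (osucc \<beta>))" using 1(1)[of \<beta>] Ord_elem[OF 1(2) b] by simp
    with sub[OF b] show "\<beta> \<in> elts (omega_pow \<alpha>)" by blast
  qed
  have O: "Ord (omega_pow \<alpha>)" using 1(2) by (rule Ord_omega_pow)
  \<comment> \<open>With remainder 0, the power taken once lies strictly below the power taken
    twice, which the next power bounds.\<close>
  have "ozero \<in> elts (omega_pow \<alpha>)" by (simp add: elts_omega_pow)
  from term_plus_rest_less[OF 1(2) this, of 1]
  have "omega_pow \<alpha> \<in> elts (omul (omega_pow \<alpha>) (ord_of_nat (Suc 1)))"
    using omul_one[OF O] by simp
  with omega_pow_less_term[OF Ord_osucc[OF 1(2)], of \<alpha> "Suc 1"]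
  have "omega_pow \<alpha> \<in> elts (omega_pow (osucc \<alpha>))" by (auto simp del: ord_of_nat.simps)
  then show ?case
    using Ord_le_less_trans[OF 1(2) _ le] Ord_omega_pow[OF Ord_osucc[OF 1(2)]] by blast
qed

subsection \<open>Cantor normal forms\<close>

text \<open>The side condition in the description \<open>cnf\<close>, kept polymorphic to serve both
  natural and integer coefficients.\<close>

definition fin_ord_supp :: "('v \<Rightarrow> 'c::zero) \<Rightarrow> bool"
  where "fin_ord_supp c \<longleftrightarrow> finite (supp c) \<and> (\<forall>\<zeta>\<in>supp c. Ord \<zeta>)"

lemma finite_Ord_has_max:
  assumes "finite S" "S \<noteq> {}" "\<And>x. x \<in> S \<Longrightarrow> Ord x"
  shows "\<exists>\<mu>\<in>S. \<forall>x\<in>S. x \<in> elts \<mu> \<or> x = \<mu>"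
  using assms
proof (induction S rule: finite_ne_induct)
  case (insert a S)
  then obtain \<mu> where m: "\<mu> \<in> S" "\<forall>x\<in>S. x \<in> elts \<mu> \<or> x = \<mu>" by auto
  have O: "Ord a" "Ord \<mu>" using insert.prems m(1) by auto
  from Ord_linear[OF O] show ?case
  proof (elim disjE)
    assume "\<mu> \<in> elts a"
    then have "\<forall>x\<in>S. x \<in> elts a" using m(2) Ord_trans[OF O(1)] by blast
    then show ?thesis by blast
  qed (use m in auto)
qed simp

text \<open>Two different heads would be members of each other. With existence below, this makes the
  description \<open>descending_list\<close> usable.\<close>

lemma descending_list_unique:
  assumes "sorted_wrt (\<lambda>x y. olt y x) xs" "sorted_wrt (\<lambda>x y. olt y x) ys" "set xs = set ys"
  shows "xs = ys"
  using assms
proof (induction xs arbitrary: ys)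
  case (Cons x xs)
  then obtain y ys' where ys: "ys = y # ys'" by (cases ys) auto
  have xy: "x = y"
  proof (rule ccontr)
    assume "x \<noteq> y"
    with Cons.prems(3) ys have "x \<in> set ys'" "y \<in> set xs" by auto
    with Cons.prems ys show False using mem_asym by (auto simp: olt_def)
  qed
  have "x \<notin> set xs" "y \<notin> set ys'"
    using Cons.prems ys not_mem_self by (auto simp: olt_def)
  with Cons.prems(3) ys xy have "set xs = set ys'" by auto
  then have "xs = ys'" using Cons.IH[of ys'] Cons.prems ys by auto
  with xy ys show ?case by simp
qed auto

lemma descending_list_set:
  assumes "sorted_wrt (\<lambda>x y. olt y x) zs"
  shows "descending_list (set zs) = zs"
  unfolding descending_list_def using assms descending_list_unique
  by (intro the_equality) auto

lemma descending_list_exists: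
  assumes "finite S" "\<And>x. x \<in> S \<Longrightarrow> Ord x"
  shows "\<exists>zs. sorted_wrt (\<lambda>x y. olt y x) zs \<and> set zs = S"
  using assms
proof (induction "card S" arbitrary: S)
  case (Suc n)
  then have "S \<noteq> {}" by auto
  from finite_Ord_has_max[OF Suc.prems(1) this Suc.prems(2)] obtain \<nu>
    where n: "\<nu> \<in> S" "\<forall>x\<in>S. x \<in> elts \<nu> \<or> x = \<nu>" by blast
  have "\<exists>zs. sorted_wrt (\<lambda>x y. olt y x) zs \<and> set zs = S - {\<nu>}"
    using Suc.hyps(2) Suc.prems n(1) by (intro Suc.hyps(1)) auto
  then obtain zs where "sorted_wrt (\<lambda>x y. olt y x) zs" "set zs = S - {\<nu>}" by blast
  with n have "sorted_wrt (\<lambda>x y. olt y x) (\<nu> # zs)" "set (\<nu> # zs) = S"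
    by (auto simp: olt_def)
  then show ?case by blast
qed simp

lemma descending_list_insert_max:
  assumes "finite S" "\<And>x. x \<in> S \<Longrightarrow> Ord x" "\<And>x. x \<in> S \<Longrightarrow> x \<in> elts \<mu>"
  shows "descending_list (insert \<mu> S) = \<mu> # descending_list S"
proof -
  from descending_list_exists[OF assms(1,2)]
  obtain zs where zs: "sorted_wrt (\<lambda>x y. olt y x) zs" "set zs = S" by blast
  with assms(3) have "sorted_wrt (\<lambda>x y. olt y x) (\<mu> # zs)" by (auto simp: olt_def)
  from descending_list_set[OF this] descending_list_set[OF zs(1)] zs(2) show ?thesis by simp
qed

lemma cnf_val_zero: "cnf_val (\<lambda>_. 0) = ozero"
  using descending_list_set[of "[]"] by (simp add: cnf_val_def supp_def)

lemma supp_upd_zero: "supp (c(\<mu> := 0)) = supp c - {\<mu>}"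
  by (auto simp: supp_def)

lemma fin_ord_supp_upd_zero: "fin_ord_supp c \<Longrightarrow> fin_ord_supp (c(\<mu> := 0))"
  by (simp add: fin_ord_supp_def supp_upd_zero)

text \<open>The recursion behind all inductions on normal forms. \<open>\<mu>\<close> need only
  bound the support: a zero coefficient contributes a zero term, so two forms with different
  supports can be peeled at a common exponent.\<close>

lemma cnf_val_peel:
  assumes "fin_ord_supp c" "supp c \<subseteq> insert \<mu> (elts \<mu>)"
  shows "cnf_val c = oadd (omul (omega_pow \<mu>) (ord_of_nat (c \<mu>))) (cnf_val (c(\<mu> := 0)))"
proof (cases "c \<mu> = 0")
  case True
  then have "c(\<mu> := 0) = c" by auto
  with True show ?thesis by simp
next
  case False
  let ?c = "c(\<mu> := 0)"
  have s: "supp c = insert \<mu> (supp ?c)" using False by (auto simp: supp_def)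
  have d: "descending_list (supp c) = \<mu> # descending_list (supp ?c)"
    unfolding s using assms fin_ord_supp_upd_zero[OF assms(1), of \<mu>]
    by (intro descending_list_insert_max) (auto simp: fin_ord_supp_def supp_upd_zero)
  have cong: "foldr (\<lambda>\<zeta> s. oadd (omul (omega_pow \<zeta>) (ord_of_nat (c \<zeta>))) s) zs r =
      foldr (\<lambda>\<zeta> s. oadd (omul (omega_pow \<zeta>) (ord_of_nat (?c \<zeta>))) s) zs r"
    if "\<mu> \<notin> set zs" for zs r
    using that by (induction zs) auto
  have "\<exists>zs. sorted_wrt (\<lambda>x y. olt y x) zs \<and> set zs = supp ?c"
    by (rule descending_list_exists)
      (use fin_ord_supp_upd_zero[OF assms(1), of \<mu>] in \<open>auto simp: fin_ord_supp_def\<close>)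
  then have "set (descending_list (supp ?c)) = supp ?c"
    using descending_list_set by metis
  then have "\<mu> \<notin> set (descending_list (supp ?c))" by (simp add: supp_upd_zero)
  then show ?thesis unfolding cnf_val_def d using cong by simp
qed

lemma fin_ord_supp_max:
  assumes "fin_ord_supp c" "supp c \<noteq> {}"
  obtains \<mu> where "Ord \<mu>" "\<mu> \<in> supp c" "supp c \<subseteq> insert \<mu> (elts \<mu>)"
  using finite_Ord_has_max[of "supp c"] assms unfolding fin_ord_supp_def by blast

text \<open>Peel the top exponent \<open>\<mu>\<close>. The rest has its exponents below
  \<open>\<mu>\<close>, so by induction with \<open>\<mu>\<close> as the bound it lies below
  \<open>\<omega>\<close>^\<open>\<mu>\<close>; the whole is then below a finite multiple of that
  power.\<close>

lemma cnf_val_less_omega_pow: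
  assumes "fin_ord_supp c" "Ord \<zeta>" "supp c \<subseteq> elts \<zeta>"
  shows "cnf_val c \<in> elts (omega_pow \<zeta>)"
  using assms
proof (induction "card (supp c)" arbitrary: c \<zeta> rule: less_induct)
  case less
  show ?case
  proof (cases "supp c = {}")
    case True
    then have "c = (\<lambda>_. 0)" by (auto simp: supp_def)
    then show ?thesis by (simp add: cnf_val_zero elts_omega_pow)
  next
    case False
    with less.prems(1) obtain \<mu> where m: "Ord \<mu>" "\<mu> \<in> supp c" "supp c \<subseteq> insert \<mu> (elts \<mu>)"
      by (rule fin_ord_supp_max)
    have "finite (supp c)" using less.prems(1) by (simp add: fin_ord_supp_def)
    then have "card (supp (c(\<mu> := 0))) < card (supp c)"
      unfolding supp_upd_zero using m(2) by (rule card_Diff1_less)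
    then have "cnf_val (c(\<mu> := 0)) \<in> elts (omega_pow \<mu>)"
      using m by (intro less.hyps fin_ord_supp_upd_zero less.prems) (auto simp: supp_upd_zero)
    from term_plus_rest_less[OF m(1) this] cnf_val_peel[OF less.prems(1) m(3)]
    have "cnf_val c \<in> elts (omul (omega_pow \<mu>) (ord_of_nat (Suc (c \<mu>))))" by simp
    then show ?thesis
      using omega_pow_less_term[OF less.prems(2), of \<mu>] m(2) less.prems(3) by blast
  qed
qed

lemma Ord_cnf_val:
  assumes "fin_ord_supp c"
  shows "Ord (cnf_val c)"
proof (cases "supp c = {}")
  case True
  then have "c = (\<lambda>_. 0)" by (auto simp: supp_def)
  then show ?thesis using Ord_ord_of_nat[of 0] by (simp add: cnf_val_zero)
next
  case False
  with assms obtain \<mu> where m: "Ord \<mu>" "\<mu> \<in> supp c" "supp c \<subseteq> insert \<mu> (elts \<mu>)"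
    by (rule fin_ord_supp_max)
  then have "cnf_val c \<in> elts (omega_pow (osucc \<mu>))"
    by (intro cnf_val_less_omega_pow assms Ord_osucc) auto
  then show ?thesis by (rule Ord_elem[OF Ord_omega_pow[OF Ord_osucc[OF m(1)]]])
qed

section \<open>Leading terms, and the comparison, uniqueness and existence of normal forms\<close>

definition lead_at :: "('v \<Rightarrow> int) \<Rightarrow> 'v \<Rightarrow> bool"
  where "lead_at f \<zeta> \<longleftrightarrow> f \<zeta> \<noteq> 0 \<and> (\<forall>\<xi>. f \<xi> \<noteq> 0 \<longrightarrow> \<xi> \<in> elts \<zeta> \<or> \<xi> = \<zeta>)"

text \<open>The positivity test for surintegers; applied to a difference of coefficient functions it
  expresses their strict order.\<close>

definition lead_pos :: "('v \<Rightarrow> int) \<Rightarrow> bool"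
  where "lead_pos f \<longleftrightarrow> (\<exists>\<zeta>. lead_at f \<zeta> \<and> f \<zeta> > 0)"

lemma lead_at_unique: "lead_at f \<zeta> \<Longrightarrow> lead_at f \<xi> \<Longrightarrow> \<zeta> = \<xi>"
  using mem_asym unfolding lead_at_def by blast

lemma lead_at_uminus: "lead_at (\<lambda>\<xi>. - f \<xi>) \<zeta> \<longleftrightarrow> lead_at f \<zeta>"
  by (simp add: lead_at_def)

lemma lead_at_exists:
  assumes "fin_ord_supp f" "f \<noteq> (\<lambda>_. 0)"
  obtains \<zeta> where "Ord \<zeta>" "lead_at f \<zeta>"
proof -
  have "supp f \<noteq> {}" using assms(2) by (auto simp: supp_def)
  with assms(1) obtain \<mu> where "Ord \<mu>" "\<mu> \<in> supp f" "supp f \<subseteq> insert \<mu> (elts \<mu>)"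
    by (rule fin_ord_supp_max)
  then show ?thesis by (intro that[of \<mu>]) (auto simp: lead_at_def supp_def)
qed

lemma lead_pos_trichotomy:
  assumes "fin_ord_supp f"
  shows "f = (\<lambda>_. 0) \<or> lead_pos f \<or> lead_pos (\<lambda>\<xi>. - f \<xi>)"
proof (cases "f = (\<lambda>_. 0)")
  case False
  with assms obtain \<zeta> where "lead_at f \<zeta>" by (rule lead_at_exists)
  moreover from this have "f \<zeta> > 0 \<or> - f \<zeta> > 0" by (auto simp: lead_at_def)
  ultimately show ?thesis unfolding lead_pos_def using lead_at_uminus by metis
qed simp

lemma lead_pos_nonzero: "lead_pos f \<Longrightarrow> f \<noteq> (\<lambda>_. 0)"
  by (auto simp: lead_pos_def)

lemma lead_pos_uminus: "lead_pos f \<Longrightarrow> \<not> lead_pos (\<lambda>\<xi>. - f \<xi>)"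
  unfolding lead_pos_def lead_at_uminus using lead_at_unique by fastforce

text \<open>Peel both forms at the greatest exponent of either. If they first differ there, the
  smaller coefficient plus any remainder stays below the larger multiple; otherwise equal terms are
  removed and the induction continues.\<close>

lemma cnf_val_less:
  assumes "fin_ord_supp c" "fin_ord_supp d" "lead_pos (\<lambda>\<xi>. int (d \<xi>) - int (c \<xi>))"
  shows "cnf_val c \<in> elts (cnf_val d)"
  using assms
proof (induction "card (supp c \<union> supp d)" arbitrary: c d rule: less_induct)
  case less
  from less.prems(3) obtain \<zeta> where z: "c \<zeta> < d \<zeta>"
    and above: "\<And>\<xi>. c \<xi> \<noteq> d \<xi> \<Longrightarrow> \<xi> \<in> elts \<zeta> \<or> \<xi> = \<zeta>"
    by (auto simp: lead_pos_def lead_at_def)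
  have fin: "finite (supp c \<union> supp d)" using less.prems by (auto simp: fin_ord_supp_def)
  have "\<zeta> \<in> supp d" using z by (auto simp: supp_def)
  then obtain \<mu> where mu: "\<mu> \<in> supp c \<union> supp d"
    and max: "supp c \<subseteq> insert \<mu> (elts \<mu>)" "supp d \<subseteq> insert \<mu> (elts \<mu>)"
    using finite_Ord_has_max[OF fin] less.prems by (auto simp: fin_ord_supp_def) blast+
  have "Ord \<mu>" using mu less.prems by (auto simp: fin_ord_supp_def)
  note peel = cnf_val_peel[OF less.prems(1) max(1)] cnf_val_peel[OF less.prems(2) max(2)]
  show ?case
  proof (cases "\<mu> = \<zeta>")
    case True
    have "cnf_val (c(\<mu> := 0)) \<in> elts (omega_pow \<mu>)"
      using max(1) by (intro cnf_val_less_omega_pow fin_ord_supp_upd_zero less.prems \<open>Ord \<mu>\<close>)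
        (auto simp: supp_upd_zero)
    from term_plus_rest_less[OF \<open>Ord \<mu>\<close> this]
    have "cnf_val c \<in> elts (omul (omega_pow \<mu>) (ord_of_nat (Suc (c \<mu>))))" by (simp add: peel)
    also have "\<dots> \<subseteq> elts (omul (omega_pow \<mu>) (ord_of_nat (d \<mu>)))"
      using z True by (intro omul_mono) (auto simp only: elts_ord_of_nat)
    also have "\<dots> \<subseteq> elts (cnf_val d)" unfolding peel(2) by (simp add: elts_oadd)
    finally show ?thesis .
  next
    case False
    \<comment> \<open>A difference at \<open>\<mu>\<close> would put \<open>\<mu>\<close> below
      \<open>\<zeta>\<close>, while \<open>\<zeta>\<close> lies below the maximum
      \<open>\<mu>\<close>.\<close>
    have eq: "c \<mu> = d \<mu>"
    proof (rule ccontr)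
      assume "c \<mu> \<noteq> d \<mu>"
      with above False have "\<mu> \<in> elts \<zeta>" by blast
      moreover have "\<zeta> \<in> elts \<mu>" using \<open>\<zeta> \<in> supp d\<close> max(2) False by blast
      ultimately show False using mem_asym by blast
    qed
    have "card (supp (c(\<mu> := 0)) \<union> supp (d(\<mu> := 0))) < card (supp c \<union> supp d)"
      using mu by (intro psubset_card_mono fin) (auto simp: supp_upd_zero)
    moreover have "(\<lambda>\<xi>. int ((d(\<mu> := 0)) \<xi>) - int ((c(\<mu> := 0)) \<xi>)) = (\<lambda>\<xi>. int (d \<xi>) - int (c \<xi>))"
      using eq by auto
    ultimately have "cnf_val (c(\<mu> := 0)) \<in> elts (cnf_val (d(\<mu> := 0)))"
      using less.prems by (intro less.hyps fin_ord_supp_upd_zero) simp_all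
    then show ?thesis unfolding peel eq by (simp add: elts_oadd)
  qed
qed

lemma fin_ord_supp_combine:
  assumes "fin_ord_supp c" "fin_ord_supp d" "\<And>\<xi>. c \<xi> = 0 \<Longrightarrow> d \<xi> = 0 \<Longrightarrow> f \<xi> = 0"
  shows "fin_ord_supp f"
proof -
  have "supp f \<subseteq> supp c \<union> supp d" using assms(3) by (auto simp: supp_def)
  then show ?thesis using assms(1,2) finite_subset unfolding fin_ord_supp_def by blast
qed

text \<open>Sign trichotomy upgrades the implication to equivalences, since the outcomes exclude
  each other. The second part is the uniqueness of normal forms that justifies
  \<open>cnf\<close>.\<close>

lemma cnf_val_less_iff:
  assumes "fin_ord_supp c" "fin_ord_supp d"
  shows "cnf_val c \<in> elts (cnf_val d) \<longleftrightarrow> lead_pos (\<lambda>\<xi>. int (d \<xi>) - int (c \<xi>))"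
    and "cnf_val c = cnf_val d \<longleftrightarrow> c = d"
proof -
  let ?f = "\<lambda>\<xi>. int (d \<xi>) - int (c \<xi>)"
  have "fin_ord_supp ?f" by (rule fin_ord_supp_combine[OF assms]) auto
  from lead_pos_trichotomy[OF this]
  have "c = d \<or> lead_pos ?f \<or> lead_pos (\<lambda>\<xi>. int (c \<xi>) - int (d \<xi>))"
    by (auto simp: fun_eq_iff)
  with cnf_val_less[OF assms] cnf_val_less[OF assms(2,1)]
  show "cnf_val c \<in> elts (cnf_val d) \<longleftrightarrow> lead_pos ?f" "cnf_val c = cnf_val d \<longleftrightarrow> c = d"
    using not_mem_self mem_asym by metis+
qed

text \<open>Division with remainder by \<open>\<omega>\<close>^\<open>\<gamma>\<close>, where
  \<open>\<gamma>\<close> is any exponent below \<open>\<eta>\<close> for which some finite multiple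
  exceeds \<open>\<alpha>\<close>; the remainder is handled by the induction hypothesis at
  \<open>\<gamma>\<close>.\<close>

lemma cnf_exists:
  assumes "Ord \<eta>" "\<alpha> \<in> elts (omega_pow \<eta>)"
  shows "\<exists>c. fin_ord_supp c \<and> supp c \<subseteq> elts \<eta> \<and> cnf_val c = \<alpha>"
  using assms
proof (induction \<eta> arbitrary: \<alpha> rule: wf_induct_rule[OF wf_memrel])
  case (1 \<eta>)
  show ?case
  proof (cases "\<alpha> = ozero")
    case True
    then show ?thesis
      by (intro exI[of _ "\<lambda>_. 0"]) (auto simp: fin_ord_supp_def supp_def cnf_val_zero simp del: ord_of_nat.simps)
  next
    case False
    with 1(3) obtain \<gamma> where g: "\<gamma> \<in> elts \<eta>" "\<alpha> \<in> elts (omul (omega_pow \<gamma>) omega)"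
      by (auto simp: elts_omega_pow)
    have Og: "Ord \<gamma>" by (rule Ord_elem[OF 1(2) g(1)])
    let ?P = "\<lambda>n. \<alpha> \<in> elts (omul (omega_pow \<gamma>) (ord_of_nat n))"
    from g(2) obtain m where m: "?P m" unfolding mem_omul_omega[OF Ord_omega_pow[OF Og]] ..
    \<comment> \<open>The quotient is one less than the first multiple exceeding
      \<open>\<alpha>\<close>. It may be 0, which just leaves \<open>\<gamma>\<close> out of the
      support.\<close>
    have "\<not> ?P 0" by simp
    from ex_least_nat_less[of ?P, OF m this] obtain n where n: "\<not> ?P n" "?P (Suc n)" by blast
    then obtain \<rho> where r: "\<rho> \<in> elts (omega_pow \<gamma>)"
      and \<alpha>: "\<alpha> = oadd (omul (omega_pow \<gamma>) (ord_of_nat n)) \<rho>"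
      unfolding omul_Suc[OF Ord_omega_pow[OF Og]] by (auto simp: elts_oadd)
    from 1(1)[of \<gamma> \<rho>] g(1) Og r obtain c where c: "fin_ord_supp c" "supp c \<subseteq> elts \<gamma>" "cnf_val c = \<rho>"
      by auto
    let ?d = "c(\<gamma> := n)"
    have sub: "supp ?d \<subseteq> insert \<gamma> (supp c)" by (auto simp: supp_def)
    have "c \<gamma> = 0" using c(2) not_mem_self[of \<gamma>] by (auto simp: supp_def)
    then have "?d(\<gamma> := 0) = c" by auto
    have d: "fin_ord_supp ?d"
      using sub c(1) Og finite_subset[OF sub] by (auto simp: fin_ord_supp_def)
    have "cnf_val ?d = \<alpha>"
      using cnf_val_peel[OF d, of \<gamma>] sub c \<open>?d(\<gamma> := 0) = c\<close> \<alpha> by auto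
    moreover have "supp ?d \<subseteq> elts \<eta>" using sub c(2) g(1) Ord_trans[OF 1(2) g(1)] by blast
    ultimately show ?thesis using d by blast
  qed
qed

lemma cnf_cnf_val:
  assumes "fin_ord_supp c"
  shows "cnf (cnf_val c) = c"
  unfolding cnf_def using assms cnf_val_less_iff(2)
  by (intro the_equality) (auto simp: fin_ord_supp_def)

text \<open>Instantiating existence at \<open>\<alpha>\<close> + 1 also yields the crude bound that
  no exponent of \<open>\<alpha>\<close> exceeds \<open>\<alpha>\<close>, from which the denominator
  of the larger negative fraction is later chosen.\<close>

lemma
  assumes "Ord \<alpha>"
  shows fin_ord_supp_cnf: "fin_ord_supp (cnf \<alpha>)"
    and cnf_val_cnf: "cnf_val (cnf \<alpha>) = \<alpha>"
    and supp_cnf: "supp (cnf \<alpha>) \<subseteq> elts (osucc \<alpha>)"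
  using cnf_exists[OF Ord_osucc[OF assms] mem_omega_pow_osucc[OF assms]] cnf_cnf_val by metis+

lemma cnf_zero: "cnf ozero = (\<lambda>_. 0)"
  using cnf_cnf_val[of "\<lambda>_. 0"] by (simp add: cnf_val_zero fin_ord_supp_def supp_def)

lemma cnf_omega_pow:
  assumes "Ord \<eta>"
  shows "cnf (omega_pow \<eta>) = (\<lambda>_. 0)(\<eta> := 1)"
proof -
  let ?c = "(\<lambda>_. 0)(\<eta> := 1) :: 'v \<Rightarrow> nat"
  have s: "supp ?c = {\<eta>}" by (auto simp: supp_def)
  then have c: "fin_ord_supp ?c" using assms by (simp add: fin_ord_supp_def)
  have u: "?c(\<eta> := 0) = (\<lambda>_. 0)" by auto
  have "cnf_val ?c = omega_pow \<eta>"
    using cnf_val_peel[OF c, of \<eta>] s omul_one[OF Ord_omega_pow[OF assms]]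
    unfolding u cnf_val_zero by simp
  with cnf_cnf_val[OF c] show ?thesis by simp
qed

lemma omega_pow_zero: "omega_pow ozero = ord_of_nat 1"
  using elts_omega_pow[of ozero] 
  by (intro extensionality) (simp add: elts_vset is_set_singleton)

lemma cnf_one: "cnf (ord_of_nat 1) = (\<lambda>_. 0)(ozero := 1)"
  using cnf_omega_pow[OF Ord_ord_of_nat[of 0]] omega_pow_zero by simp


subsection \<open>Natural sum and product\<close>

lemma fin_ord_supp_add_cnf:
  "Ord \<alpha> \<Longrightarrow> Ord \<beta> \<Longrightarrow> fin_ord_supp (\<lambda>\<zeta>. cnf \<alpha> \<zeta> + cnf \<beta> \<zeta>)"
  by (rule fin_ord_supp_combine[OF fin_ord_supp_cnf fin_ord_supp_cnf]) auto

lemma Ord_nadd: "Ord \<alpha> \<Longrightarrow> Ord \<beta> \<Longrightarrow> Ord (nadd \<alpha> \<beta>)"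
  unfolding nadd_def by (intro Ord_cnf_val fin_ord_supp_add_cnf)

lemma cnf_nadd: "Ord \<alpha> \<Longrightarrow> Ord \<beta> \<Longrightarrow> cnf (nadd \<alpha> \<beta>) = (\<lambda>\<zeta>. cnf \<alpha> \<zeta> + cnf \<beta> \<zeta>)"
  unfolding nadd_def by (intro cnf_cnf_val fin_ord_supp_add_cnf)

lemma less_iff_cnf:
  assumes "Ord \<alpha>" "Ord \<beta>"
  shows "\<alpha> \<in> elts \<beta> \<longleftrightarrow> lead_pos (\<lambda>\<zeta>. int (cnf \<beta> \<zeta>) - int (cnf \<alpha> \<zeta>))"
  using cnf_val_less_iff(1)[OF fin_ord_supp_cnf[OF assms(1)] fin_ord_supp_cnf[OF assms(2)]]
  by (simp add: cnf_val_cnf assms)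

lemma nadd_commute: "nadd \<alpha> \<beta> = nadd \<beta> \<alpha>"
  by (simp add: nadd_def add.commute)

text \<open>The common summand cancels in the difference of coefficient functions, which alone
  decides the order.\<close>

lemma nadd_less_mono_left:
  assumes "Ord \<alpha>" "Ord \<beta>" "\<alpha>' \<in> elts \<alpha>"
  shows "nadd \<alpha>' \<beta> \<in> elts (nadd \<alpha> \<beta>)"
proof -
  have "Ord \<alpha>'" by (rule Ord_elem[OF assms(1,3)])
  with assms show ?thesis by (simp add: less_iff_cnf Ord_nadd cnf_nadd)
qed

text \<open>The equality case is isolated so that, in a product, only one pair of exponents can
  reach the top sum.\<close>

lemma nadd_less_mono:
  assumes "Ord \<alpha>" "Ord \<beta>" "\<alpha>' \<in> elts \<alpha> \<or> \<alpha>' = \<alpha>" "\<beta>' \<in> elts \<beta> \<or> \<beta>' = \<beta>"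
  shows "nadd \<alpha>' \<beta>' \<in> elts (nadd \<alpha> \<beta>) \<or> \<alpha>' = \<alpha> \<and> \<beta>' = \<beta>"
proof -
  have O: "Ord \<alpha>'" "Ord \<beta>'"
    using assms Ord_elem[OF assms(1)] Ord_elem[OF assms(2)] by auto
  have "nadd \<alpha>' \<beta>' \<in> elts (nadd \<alpha> \<beta>') \<or> \<alpha>' = \<alpha>"
    using nadd_less_mono_left[OF assms(1) O(2)] assms(3) by blast
  moreover have "nadd \<alpha> \<beta>' \<in> elts (nadd \<alpha> \<beta>) \<or> \<beta>' = \<beta>"
    using nadd_less_mono_left[OF assms(2,1)] assms(4) nadd_commute by metis
  ultimately show ?thesis using Ord_trans[OF Ord_nadd[OF assms(1,2)]] by blast
qed

lemma nadd_zero_left: "Ord \<alpha> \<Longrightarrow> nadd ozero \<alpha> = \<alpha>"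
  using cnf_val_cnf unfolding nadd_def cnf_zero by simp

lemma nadd_eq_zero:
  assumes "Ord \<alpha>" "Ord \<beta>" "nadd \<alpha> \<beta> = ozero"
  shows "\<alpha> = ozero"
proof -
  have "cnf \<alpha> = (\<lambda>_. 0)"
    using cnf_nadd[OF assms(1,2)] assms(3) cnf_zero by (auto simp: fun_eq_iff)
  then show ?thesis using cnf_val_cnf[OF assms(1)] cnf_val_zero by simp
qed

section \<open>Convolution of coefficient functions and rules for signs\<close>

lemma conv_eq_zero:
  assumes "\<And>\<xi> \<eta>. c \<xi> \<noteq> 0 \<Longrightarrow> d \<eta> \<noteq> 0 \<Longrightarrow> nadd \<xi> \<eta> \<noteq> \<zeta>"
  shows "conv c d \<zeta> = 0"
proof -
  have "{(\<xi>, \<eta>) \<in> supp c \<times> supp d. nadd \<xi> \<eta> = \<zeta>} = {}"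
    using assms by (auto simp: supp_def)
  then show ?thesis unfolding conv_def by (simp only: sum.empty)
qed

lemma fin_ord_supp_conv:
  assumes "fin_ord_supp c" "fin_ord_supp d"
  shows "fin_ord_supp (conv c d)"
proof -
  have "\<exists>p\<in>supp c \<times> supp d. nadd (fst p) (snd p) = \<zeta>" if "conv c d \<zeta> \<noteq> 0" for \<zeta>
    using conv_eq_zero[of c d \<zeta>] that by (force simp: supp_def)
  then have sub: "supp (conv c d) \<subseteq> (\<lambda>p. nadd (fst p) (snd p)) ` (supp c \<times> supp d)"
    by (force simp: supp_def[of "conv c d"])
  have "Ord \<zeta>" if "\<zeta> \<in> supp (conv c d)" for \<zeta>
    using assms subsetD[OF sub that] by (auto simp: fin_ord_supp_def intro: Ord_nadd)
  with assms show ?thesis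
    unfolding fin_ord_supp_def by (auto intro: finite_subset[OF sub])
qed

lemma Ord_nmul: "Ord \<alpha> \<Longrightarrow> Ord \<beta> \<Longrightarrow> Ord (nmul \<alpha> \<beta>)"
  unfolding nmul_def by (intro Ord_cnf_val fin_ord_supp_conv fin_ord_supp_cnf)

text \<open>Every other pair of exponents has a strictly smaller natural sum, so nothing can cancel
  the product of the leading coefficients.\<close>

lemma conv_lead:
  assumes "lead_at f \<zeta>" "lead_at g \<xi>" "Ord \<zeta>" "Ord \<xi>"
  shows "conv f g (nadd \<zeta> \<xi>) = f \<zeta> * g \<xi>" and "lead_at (conv f g) (nadd \<zeta> \<xi>)"
proof -
  have less: "nadd \<zeta>' \<xi>' \<in> elts (nadd \<zeta> \<xi>) \<or> \<zeta>' = \<zeta> \<and> \<xi>' = \<xi>" if "f \<zeta>' \<noteq> 0" "g \<xi>' \<noteq> 0" for \<zeta>' \<xi>'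
    using that assms by (intro nadd_less_mono) (auto simp: lead_at_def)
  have "{(\<zeta>', \<xi>') \<in> supp f \<times> supp g. nadd \<zeta>' \<xi>' = nadd \<zeta> \<xi>} = {(\<zeta>, \<xi>)}"
    using less assms not_mem_self by (fastforce simp: lead_at_def supp_def)
  then show val: "conv f g (nadd \<zeta> \<xi>) = f \<zeta> * g \<xi>" unfolding conv_def by simp
  show "lead_at (conv f g) (nadd \<zeta> \<xi>)"
    unfolding lead_at_def
  proof (intro conjI allI impI)
    show "conv f g (nadd \<zeta> \<xi>) \<noteq> 0" using val assms by (simp add: lead_at_def)
    fix \<eta> assume "conv f g \<eta> \<noteq> 0"
    with conv_eq_zero[of f g \<eta>] obtain \<zeta>' \<xi>' where "f \<zeta>' \<noteq> 0" "g \<xi>' \<noteq> 0" "nadd \<zeta>' \<xi>' = \<eta>"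
      by blast
    with less show "\<eta> \<in> elts (nadd \<zeta> \<xi>) \<or> \<eta> = nadd \<zeta> \<xi>" by blast
  qed
qed

lemma conv_uminus_left: "conv (\<lambda>\<zeta>. - f \<zeta>) g = (\<lambda>\<zeta>. - conv f g \<zeta> :: int)"
  by (auto simp: conv_def supp_def sum_negf[symmetric] intro!: sum.cong)

lemma lead_pos_conv:
  assumes "fin_ord_supp f" "fin_ord_supp g" "lead_pos f" "lead_pos g"
  shows "lead_pos (conv f g)"
proof -
  obtain \<zeta> \<xi> where l: "lead_at f \<zeta>" "f \<zeta> > 0" "lead_at g \<xi>" "g \<xi> > 0"
    using assms(3,4) by (auto simp: lead_pos_def)
  then have "Ord \<zeta>" "Ord \<xi>" using assms(1,2) by (auto simp: lead_at_def fin_ord_supp_def supp_def)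
  with l conv_lead[of f \<zeta> g \<xi>] show ?thesis unfolding lead_pos_def by auto
qed

lemma lead_at_add_dominated:
  assumes "lead_at u \<alpha>" "\<And>\<eta>. v \<eta> \<noteq> 0 \<Longrightarrow> \<eta> \<in> elts \<alpha>"
  shows "lead_at (\<lambda>\<zeta>. u \<zeta> + v \<zeta>) \<alpha>" and "v \<alpha> = 0"
proof -
  show "v \<alpha> = 0" using assms(2) not_mem_self by blast
  moreover have "\<xi> \<in> elts \<alpha> \<or> \<xi> = \<alpha>" if "u \<xi> + v \<xi> \<noteq> 0" for \<xi>
    using that assms unfolding lead_at_def by (cases "v \<xi> = 0") auto
  ultimately show "lead_at (\<lambda>\<zeta>. u \<zeta> + v \<zeta>) \<alpha>" using assms(1) by (simp add: lead_at_def)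
qed

text \<open>The larger leading exponent dominates; when they agree, two positive coefficients cannot
  cancel.\<close>

lemma lead_pos_add:
  assumes "fin_ord_supp f" "fin_ord_supp g" "lead_pos f" "lead_pos g"
  shows "lead_pos (\<lambda>\<zeta>. f \<zeta> + g \<zeta>)"
proof -
  obtain \<zeta> \<xi> where l: "lead_at f \<zeta>" "f \<zeta> > 0" "lead_at g \<xi>" "g \<xi> > 0"
    using assms(3,4) by (auto simp: lead_pos_def)
  then have O: "Ord \<zeta>" "Ord \<xi>" using assms(1,2) by (auto simp: lead_at_def fin_ord_supp_def supp_def)
  have dom: "lead_pos (\<lambda>\<zeta>. u \<zeta> + v \<zeta>)"
    if "lead_at u \<alpha>" "u \<alpha> > 0" "lead_at v \<beta>" "Ord \<alpha>" "\<beta> \<in> elts \<alpha>" for u v \<alpha> \<beta>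
  proof -
    have "\<eta> \<in> elts \<alpha>" if "v \<eta> \<noteq> 0" for \<eta>
      using that \<open>lead_at v \<beta>\<close> Ord_trans[OF \<open>Ord \<alpha>\<close> \<open>\<beta> \<in> elts \<alpha>\<close>] \<open>\<beta> \<in> elts \<alpha>\<close>
      by (auto simp: lead_at_def)
    from lead_at_add_dominated[OF that(1), of v, OF this] that(2) show ?thesis
      unfolding lead_pos_def by (intro exI[of _ \<alpha>]) simp
  qed
  from Ord_linear[OF O] show ?thesis
  proof (elim disjE)
    assume "\<zeta> \<in> elts \<xi>"
    then show ?thesis using dom[of g \<xi> f \<zeta>] l O by (simp add: add.commute)
  next
    assume eq: "\<zeta> = \<xi>"
    have "\<eta> \<in> elts \<zeta> \<or> \<eta> = \<zeta>" if "f \<eta> + g \<eta> \<noteq> 0" for \<eta>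
      using that l eq unfolding lead_at_def by (cases "g \<eta> = 0") auto
    with l eq show ?thesis
      unfolding lead_pos_def lead_at_def by (intro exI[of _ \<zeta>]) auto
  next
    assume "\<xi> \<in> elts \<zeta>"
    then show ?thesis using dom[of f \<zeta> g \<xi>] l O by simp
  qed
qed


subsection \<open>Surintegers and fractions\<close>

lemma zcoeff_kpair: "zcoeff (kpair \<alpha> \<beta>) \<zeta> = int (cnf \<alpha> \<zeta>) - int (cnf \<beta> \<zeta>)"
  by (simp add: zcoeff_def)

lemma Z_infE:
  assumes "z \<in> Z_inf"
  obtains \<alpha> \<beta> where "z = kpair \<alpha> \<beta>" "Ord \<alpha>" "Ord \<beta>" "supp (cnf \<alpha>) \<inter> supp (cnf \<beta>) = {}"
  using assms unfolding Z_inf_def by blast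

lemma kpair_in_Z_inf:
  "kpair \<alpha> \<beta> \<in> Z_inf \<longleftrightarrow> Ord \<alpha> \<and> Ord \<beta> \<and> supp (cnf \<alpha>) \<inter> supp (cnf \<beta>) = {}"
  by (auto simp: Z_inf_def kpair_inject)

lemma fin_ord_supp_zcoeff:
  assumes "z \<in> Z_inf"
  shows "fin_ord_supp (zcoeff z)"
proof -
  from assms obtain \<alpha> \<beta> where "z = kpair \<alpha> \<beta>" "Ord \<alpha>" "Ord \<beta>" by (rule Z_infE)
  then show ?thesis
    by (intro fin_ord_supp_combine[OF fin_ord_supp_cnf[of \<alpha>] fin_ord_supp_cnf[of \<beta>]])
      (auto simp: zcoeff_kpair)
qed

text \<open>Disjoint exponents leave no cancellation, so the positive and negative parts of the
  difference are the two coordinates. Hence a surinteger is determined by its coefficients.\<close>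

lemma z_of_coeff_zcoeff:
  assumes "z \<in> Z_inf"
  shows "z_of_coeff (zcoeff z) = z"
proof -
  from assms obtain \<alpha> \<beta> where z: "z = kpair \<alpha> \<beta>" "Ord \<alpha>" "Ord \<beta>"
    and disj: "supp (cnf \<alpha>) \<inter> supp (cnf \<beta>) = {}" by (rule Z_infE)
  have "cnf \<alpha> \<zeta> = 0 \<or> cnf \<beta> \<zeta> = 0" for \<zeta> using disj by (auto simp: supp_def)
  then have "(\<lambda>\<zeta>. nat (zcoeff z \<zeta>)) = cnf \<alpha>" "(\<lambda>\<zeta>. nat (- zcoeff z \<zeta>)) = cnf \<beta>"
    unfolding z(1) zcoeff_kpair by (auto simp: fun_eq_iff) (metis diff_zero nat_int diff_0 minus_minus of_nat_0 nat_zminus_int)+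
  with z show ?thesis by (simp add: z_of_coeff_def cnf_val_cnf)
qed

lemma
  assumes "fin_ord_supp f"
  shows z_of_coeff_in_Z_inf: "z_of_coeff f \<in> Z_inf"
    and zcoeff_z_of_coeff: "zcoeff (z_of_coeff f) = f"
proof -
  have fin: "fin_ord_supp (\<lambda>\<zeta>. nat (f \<zeta>))" "fin_ord_supp (\<lambda>\<zeta>. nat (- f \<zeta>))"
    by (rule fin_ord_supp_combine[OF assms assms]; simp)+
  note cnf = cnf_cnf_val[OF fin(1)] cnf_cnf_val[OF fin(2)]
  show "z_of_coeff f \<in> Z_inf"
    unfolding z_of_coeff_def kpair_in_Z_inf cnf using Ord_cnf_val[OF fin(1)] Ord_cnf_val[OF fin(2)]
    by (auto simp: supp_def)
  show "zcoeff (z_of_coeff f) = f"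
    unfolding z_of_coeff_def zcoeff_def by (auto simp: cnf fun_eq_iff)
qed

text \<open>Totality of the ordinals turns the comparison of cross sums into a negated strict one,
  and the coefficients of those sums regroup into the two differences.\<close>

lemma zle_iff:
  assumes "z \<in> Z_inf" "w \<in> Z_inf"
  shows "zle z w \<longleftrightarrow> \<not> lead_pos (\<lambda>\<zeta>. zcoeff z \<zeta> - zcoeff w \<zeta>)"
proof -
  from assms(1) obtain \<alpha> \<beta> where z: "z = kpair \<alpha> \<beta>" "Ord \<alpha>" "Ord \<beta>" by (rule Z_infE)
  from assms(2) obtain \<gamma> \<delta> where w: "w = kpair \<gamma> \<delta>" "Ord \<gamma>" "Ord \<delta>" by (rule Z_infE)
  have "zle z w \<longleftrightarrow> nadd \<gamma> \<beta> \<notin> elts (nadd \<alpha> \<delta>)"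
    using z w by (simp add: zle_def Ord_ole_total Ord_nadd olt_def)
  also have "\<dots> \<longleftrightarrow> \<not> lead_pos (\<lambda>\<zeta>. zcoeff z \<zeta> - zcoeff w \<zeta>)"
    using z w by (simp add: less_iff_cnf Ord_nadd cnf_nadd zcoeff_kpair algebra_simps)
  finally show ?thesis .
qed

lemma
  assumes "z \<in> Z_inf" "w \<in> Z_inf"
  shows zmul_in_Z_inf: "zmul z w \<in> Z_inf"
    and zcoeff_zmul: "zcoeff (zmul z w) = conv (zcoeff z) (zcoeff w)"
  unfolding zmul_def using fin_ord_supp_conv fin_ord_supp_zcoeff assms
  by (blast intro: z_of_coeff_in_Z_inf zcoeff_z_of_coeff)+

lemma kpair_zero_left_in_Z_inf: "Ord \<alpha> \<Longrightarrow> kpair ozero \<alpha> \<in> Z_inf"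
  and kpair_zero_right_in_Z_inf: "Ord \<alpha> \<Longrightarrow> kpair \<alpha> ozero \<in> Z_inf"
  using Ord_ord_of_nat[of 0] by (simp_all add: kpair_in_Z_inf cnf_zero supp_def del: ord_of_nat.simps)

lemma zzero_in_Z_inf: "zzero \<in> Z_inf"
  unfolding zzero_def by (rule kpair_zero_left_in_Z_inf[OF Ord_ord_of_nat])

lemma zone_in_Z_inf: "zone \<in> Z_inf"
  unfolding zone_def by (rule kpair_zero_right_in_Z_inf[OF Ord_ord_of_nat])

lemma zcoeff_zzero: "zcoeff zzero = (\<lambda>_. 0)"
  unfolding zzero_def by (rule ext) (simp add: zcoeff_kpair)

lemma zcoeff_zone: "zcoeff zone = (\<lambda>_. 0)(ozero := 1)"
  unfolding zone_def by (rule ext) (simp only: zcoeff_kpair cnf_zero cnf_one, simp)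

lemma zcoeff_neg_one: "zcoeff (kpair ozero (ord_of_nat 1)) = (\<lambda>_. 0)(ozero := -1)"
  by (rule ext) (simp only: zcoeff_kpair cnf_zero cnf_one, simp)

text \<open>The leading exponents of the two factors have natural sum 0, so both are 0. Then
  \<open>d\<close> is an integer constant dividing 1 or -1.\<close>

lemma zdvd_unit:
  assumes "d \<in> Z_inf" "zdvd d z" "zcoeff z = (\<lambda>_. 0)(ozero := k)" "\<bar>k\<bar> = 1"
  shows "d = zone \<or> d = zneg zone"
proof -
  from assms(2) obtain e where e: "e \<in> Z_inf" "z = zmul d e" by (auto simp: zdvd_def)
  have conv: "conv (zcoeff d) (zcoeff e) = (\<lambda>_. 0)(ozero := k)"
    using zcoeff_zmul[OF assms(1) e(1)] e(2) assms(3) by simp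
  have k: "conv (zcoeff d) (zcoeff e) ozero \<noteq> 0" unfolding conv using assms(4) by auto
  have "zcoeff d \<noteq> (\<lambda>_. 0)" "zcoeff e \<noteq> (\<lambda>_. 0)"
    using conv_eq_zero[of "zcoeff d" "zcoeff e" ozero] k by force+
  then obtain \<zeta> \<xi> where l: "Ord \<zeta>" "lead_at (zcoeff d) \<zeta>" "Ord \<xi>" "lead_at (zcoeff e) \<xi>"
    using lead_at_exists[OF fin_ord_supp_zcoeff[OF assms(1)]]
      lead_at_exists[OF fin_ord_supp_zcoeff[OF e(1)]] by metis
  note cl = conv_lead[OF l(2,4,1,3)]
  \<comment> \<open>The product is nonzero at its leading exponent, and 0 is its only
    exponent.\<close>
  have nz: "nadd \<zeta> \<xi> = ozero"
    using cl(2) unfolding lead_at_def conv by (metis fun_upd_other)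
  then have "\<zeta> = ozero" by (rule nadd_eq_zero[OF l(1,3)])
  then have d: "zcoeff d \<zeta>' = 0" if "\<zeta>' \<noteq> ozero" for \<zeta>'
    using l(2) that by (auto simp: lead_at_def)
  have "zcoeff d ozero * zcoeff e \<xi> = k"
    using cl(1) nz \<open>\<zeta> = ozero\<close> conv by (metis fun_upd_same)
  then have "\<bar>zcoeff d ozero\<bar> = 1" using assms(4) abs_zmult_eq_1 by blast
  then consider "zcoeff d ozero = 1" | "zcoeff d ozero = -1" by linarith
  then show ?thesis
  proof cases
    case 1
    with d have "zcoeff d = zcoeff zone" unfolding zcoeff_zone by (auto simp: fun_eq_iff)
    then have "z_of_coeff (zcoeff d) = z_of_coeff (zcoeff zone)" by (rule arg_cong)
    then show ?thesis
      unfolding z_of_coeff_zcoeff[OF assms(1)] z_of_coeff_zcoeff[OF zone_in_Z_inf] ..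
  next
    case 2
    with d have "zcoeff d = (\<lambda>\<zeta>. - zcoeff zone \<zeta>)"
      unfolding zcoeff_zone by (auto simp: fun_eq_iff)
    then have "z_of_coeff (zcoeff d) = zneg zone" unfolding zneg_def by (rule arg_cong)
    then show ?thesis unfolding z_of_coeff_zcoeff[OF assms(1)] ..
  qed
qed

lemma Q_infE:
  assumes "q \<in> Q_inf"
  obtains a b where "q = kpair a b" "a \<in> Z_inf" "b \<in> Z_inf" "lead_pos (zcoeff b)"
proof -
  from assms obtain a b where q: "q = kpair a b" "a \<in> Z_inf" "b \<in> Z_inf"
    and b: "zle zzero b" "b \<noteq> zzero"
    unfolding Q_inf_def by blast
  have "zcoeff b \<noteq> (\<lambda>_. 0)"
    using b(2) z_of_coeff_zcoeff[OF q(3)] z_of_coeff_zcoeff[OF zzero_in_Z_inf]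
    by (auto simp: zcoeff_zzero)
  moreover have "\<not> lead_pos (\<lambda>\<zeta>. - zcoeff b \<zeta>)"
    using b(1) by (simp add: zle_iff zzero_in_Z_inf q(3) zcoeff_zzero)
  ultimately have "lead_pos (zcoeff b)"
    using lead_pos_trichotomy[OF fin_ord_supp_zcoeff[OF q(3)]] by blast
  with q show ?thesis by (rule that)
qed

text \<open>Coprimality is certified by a single unit entry \<open>c\<close>: the numerator of
  -1/\<open>\<omega>\<close>^\<open>\<eta>\<close>, the denominator of 0/1 and of
  -\<open>\<alpha>\<close>/1.\<close>

lemma kpair_in_Q_inf:
  assumes "a \<in> Z_inf" "b \<in> Z_inf" "lead_pos (zcoeff b)"
    and unit: "c = a \<or> c = b" "zcoeff c = (\<lambda>_. 0)(ozero := k)" "\<bar>k\<bar> = 1"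
  shows "kpair a b \<in> Q_inf"
proof -
  have "zle zzero b"
    using lead_pos_uminus[OF assms(3)]
    by (simp add: zle_iff zzero_in_Z_inf assms(2) zcoeff_zzero)
  moreover have "b \<noteq> zzero" using lead_pos_nonzero[OF assms(3)] zcoeff_zzero by auto
  moreover have "d = zone \<or> d = zneg zone" if "d \<in> Z_inf" "zdvd d a" "zdvd d b" for d
    using zdvd_unit[OF that(1) _ unit(2,3)] that unit(1) by blast
  ultimately show ?thesis unfolding Q_inf_def using assms(1,2) by blast
qed

lemma qle_iff:
  assumes "a \<in> Z_inf" "b \<in> Z_inf" "c \<in> Z_inf" "d \<in> Z_inf"
  shows "qle (kpair a b) (kpair c d) \<longleftrightarrow>
    \<not> lead_pos (\<lambda>\<zeta>. conv (zcoeff a) (zcoeff d) \<zeta> - conv (zcoeff b) (zcoeff c) \<zeta>)"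
  using assms by (simp add: qle_def zle_iff zmul_in_Z_inf zcoeff_zmul)

lemma kpair_in_Z_below:
  "kpair \<alpha> \<beta> \<in> Z_below l \<longleftrightarrow> kpair \<alpha> \<beta> \<in> Z_inf \<and> \<alpha> \<in> elts l \<and> \<beta> \<in> elts l"
  by (simp add: Z_below_def olt_def)

lemma is_set_Z_below: "is_set (Z_below l)"
  by (rule is_set_mono[OF _ is_set_kpairs[OF is_set_elts[of l] is_set_elts[of l]]])
    (auto simp: Z_below_def Z_inf_def olt_def)

lemma is_set_Q_below: "is_set (Q_below l)"
  by (rule is_set_mono[OF _ is_set_kpairs[OF is_set_Z_below[of l] is_set_Z_below[of l]]])
    (auto simp: Q_below_def Q_inf_def kpair_inject)


subsection \<open>The cut of negative fractions\<close>

text \<open>Denominators are positive, so the sign of a fraction is that of its numerator.\<close>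

definition neg_fractions :: "'v \<Rightarrow> 'v set"
  where "neg_fractions l = {q \<in> Q_below l. lead_pos (\<lambda>\<zeta>. - zcoeff (vfst q) \<zeta>)}"

lemma elts_neg_fractions: "elts (vset (neg_fractions l)) = neg_fractions l"
  by (rule elts_vset, rule is_set_mono[OF _ is_set_Q_below]) (auto simp: neg_fractions_def)

text \<open>For a/b < 0 \<le> c/d the difference bc - ad equals (-a)d + bc, a positive product plus
  a nonnegative one.\<close>

lemma qlt_neg_fractions:
  assumes "p \<in> neg_fractions l" "q \<in> Q_below l - neg_fractions l"
  shows "qlt p q"
proof -
  have "p \<in> Q_inf" "q \<in> Q_inf" using assms by (auto simp: neg_fractions_def Q_below_def)
  from \<open>p \<in> Q_inf\<close> obtain a b where p: "p = kpair a b" "a \<in> Z_inf" "b \<in> Z_inf" "lead_pos (zcoeff b)"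
    by (rule Q_infE)
  from \<open>q \<in> Q_inf\<close> obtain c d where q: "q = kpair c d" "c \<in> Z_inf" "d \<in> Z_inf" "lead_pos (zcoeff d)"
    by (rule Q_infE)
  note fin = fin_ord_supp_zcoeff[OF p(2)] fin_ord_supp_zcoeff[OF p(3)]
    fin_ord_supp_zcoeff[OF q(2)] fin_ord_supp_zcoeff[OF q(3)]
  let ?u = "conv (\<lambda>\<zeta>. - zcoeff a \<zeta>) (zcoeff d)" and ?v = "conv (zcoeff b) (zcoeff c)"
  have "lead_pos (\<lambda>\<zeta>. - zcoeff a \<zeta>)" using assms(1) p(1) by (simp add: neg_fractions_def)
  moreover have fa: "fin_ord_supp (\<lambda>\<zeta>. - zcoeff a \<zeta>)"
    by (rule fin_ord_supp_combine[OF fin(1,1)]) simp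
  ultimately have u: "lead_pos ?u" using lead_pos_conv fin(4) q(4) by blast
  have "\<not> lead_pos (\<lambda>\<zeta>. - zcoeff c \<zeta>)" using assms(2) q(1) by (auto simp: neg_fractions_def)
  then consider "zcoeff c = (\<lambda>_. 0)" | "lead_pos (zcoeff c)"
    using lead_pos_trichotomy[OF fin(3)] by blast
  then have "lead_pos (\<lambda>\<zeta>. ?u \<zeta> + ?v \<zeta>)"
  proof cases
    case 1
    then have "?v = (\<lambda>_. 0)" by (intro ext conv_eq_zero) simp
    with u show ?thesis by simp
  next
    case 2
    then show ?thesis
      by (intro lead_pos_add fin_ord_supp_conv fa fin u lead_pos_conv p(4))
  qed
  from lead_pos_uminus[OF this] have "qle p q"
    unfolding p(1) q(1) qle_iff[OF p(2,3) q(2,3)] by (simp add: conv_uminus_left)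
  \<comment> \<open>Strictness only asks for \<open>p \<noteq> q\<close>, which holds because just
    one of them is in \<open>neg_fractions l\<close>.\<close>
  then show ?thesis using assms by (auto simp: qlt_def)
qed

text \<open>Multiplying out, a/b < -1/\<open>\<omega>\<close>^\<open>\<eta>\<close> says that
  \<open>\<omega>\<close>^\<open>\<eta>\<close>(-a) - b is positive. The first product leads at an
  exponent at least \<open>\<eta>\<close>, and all exponents of b are smaller.\<close>

lemma neg_fractions_no_greatest:
  assumes l: "Ord l" "elts omega \<subseteq> elts l" "\<And>\<beta>. \<beta> \<in> elts l \<Longrightarrow> omega_pow (osucc \<beta>) \<in> elts l"
    and m: "m \<in> neg_fractions l"
  shows "\<exists>x\<in>neg_fractions l. \<not> qle x m"
proof -
  have "m \<in> Q_inf" using m by (simp add: neg_fractions_def Q_below_def)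
  then obtain a b where ab: "m = kpair a b" "a \<in> Z_inf" "b \<in> Z_inf" "lead_pos (zcoeff b)"
    by (rule Q_infE)
  from ab(3) obtain \<beta> \<gamma> where b: "b = kpair \<beta> \<gamma>" "Ord \<beta>" "Ord \<gamma>" by (rule Z_infE)
  have bl: "\<beta> \<in> elts l" "\<gamma> \<in> elts l"
    using m ab(1) b(1) by (auto simp: neg_fractions_def Q_below_def kpair_in_Z_below)
  \<comment> \<open>\<open>\<mu>\<close> is the larger coordinate of \<open>b\<close>; the
    inclusions compare successors because exponents are bounded by \<open>osucc\<close>.\<close>
  obtain \<mu> where mu: "\<mu> \<in> elts l" "elts (osucc \<beta>) \<subseteq> elts (osucc \<mu>)" "elts (osucc \<gamma>) \<subseteq> elts (osucc \<mu>)"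
  proof -
    have "elts (osucc \<beta>) \<subseteq> elts (osucc \<gamma>) \<or> elts (osucc \<gamma>) \<subseteq> elts (osucc \<beta>)"
      unfolding elts_osucc
      using Ord_linear[OF b(2,3)] Ord_trans[OF b(2)] Ord_trans[OF b(3)] by blast
    then show ?thesis using that[OF bl(1)] that[OF bl(2)] by blast
  qed
  \<comment> \<open>Above all exponents of \<open>b\<close> by \<open>supp_cnf\<close>, and of the
    form for which the third hypothesis keeps \<open>omega_pow \<eta>\<close> below
    \<open>l\<close>.\<close>
  define \<eta> where "\<eta> = osucc \<mu>"
  have O: "Ord \<eta>" unfolding \<eta>_def by (intro Ord_osucc Ord_elem[OF l(1) mu(1)])
  have exps: "\<zeta> \<in> elts \<eta>" if "zcoeff b \<zeta> \<noteq> 0" for \<zeta>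
  proof -
    have "\<zeta> \<in> supp (cnf \<beta>) \<union> supp (cnf \<gamma>)"
      using that unfolding b(1) zcoeff_kpair by (auto simp: supp_def)
    then show ?thesis using supp_cnf[OF b(2)] supp_cnf[OF b(3)] mu(2,3) unfolding \<eta>_def by blast
  qed
  let ?n = "kpair ozero (ord_of_nat 1)" and ?d = "kpair (omega_pow \<eta>) ozero"
  have nat_l: "ord_of_nat n \<in> elts l" for n using l(2) elts_omega by blast
  have n: "?n \<in> Z_inf" by (rule kpair_zero_left_in_Z_inf[OF Ord_ord_of_nat])
  have d: "?d \<in> Z_inf" by (rule kpair_zero_right_in_Z_inf[OF Ord_omega_pow[OF O]])
  have zd: "zcoeff ?d = (\<lambda>_. 0)(\<eta> := 1)"
    by (rule ext) (simp only: zcoeff_kpair cnf_zero cnf_omega_pow[OF O], simp)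
  have lead_d: "lead_at (zcoeff ?d) \<eta>" unfolding zd by (simp add: lead_at_def)
  have "lead_pos (zcoeff ?d)"
    using lead_d unfolding lead_pos_def zd by (intro exI[of _ \<eta>]) simp
  then have "kpair ?n ?d \<in> Q_inf"
    by (rule kpair_in_Q_inf[OF n d _ disjI1[OF refl] zcoeff_neg_one]) simp
  then have "kpair ?n ?d \<in> Q_below l"
    using n d nat_l l(3)[OF mu(1)] by (simp only: Q_below_def mem_Collect_eq vfst_kpair vsnd_kpair
      kpair_in_Z_below \<eta>_def)
  moreover have "lead_pos (\<lambda>\<zeta>. - zcoeff ?n \<zeta>)"
    unfolding zcoeff_neg_one lead_pos_def lead_at_def by (intro exI[of _ ozero]) auto
  ultimately have x: "kpair ?n ?d \<in> neg_fractions l"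
    by (simp only: neg_fractions_def mem_Collect_eq vfst_kpair)
  have "lead_pos (\<lambda>\<zeta>. - zcoeff a \<zeta>)" using m ab(1) by (simp add: neg_fractions_def)
  then obtain \<xi> where xi: "lead_at (zcoeff a) \<xi>" "zcoeff a \<xi> < 0"
    unfolding lead_pos_def lead_at_uminus by auto
  then have Oxi: "Ord \<xi>"
    using fin_ord_supp_zcoeff[OF ab(2)] by (auto simp: fin_ord_supp_def supp_def)
  let ?u = "\<lambda>\<zeta>. - conv (zcoeff ?d) (zcoeff a) \<zeta>" and ?v = "conv (zcoeff ?n) (zcoeff b)"
  have lead_u: "lead_at ?u (nadd \<eta> \<xi>)"
    unfolding lead_at_uminus by (rule conv_lead[OF lead_d xi(1) O Oxi])
  have "conv (zcoeff ?d) (zcoeff a) (nadd \<eta> \<xi>) = zcoeff a \<xi>"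
    using conv_lead(1)[OF lead_d xi(1) O Oxi] by (simp only: zd fun_upd_same mult_1)
  with xi(2) have u: "?u (nadd \<eta> \<xi>) > 0" by simp
  \<comment> \<open>The numerator may be a constant, so \<open>\<xi>\<close> = 0 is possible and
    only a weak inequality between \<open>\<eta>\<close> and the sum is available.\<close>
  have "ozero \<in> elts \<xi> \<or> ozero = \<xi>" using Ord_linear[OF Ord_ord_of_nat[of 0] Oxi] by auto
  with nadd_less_mono[OF O Oxi, of \<eta> ozero]
  have "nadd \<eta> ozero \<in> elts (nadd \<eta> \<xi>) \<or> nadd \<eta> ozero = nadd \<eta> \<xi>" by auto
  then have eta: "\<eta> \<in> elts (nadd \<eta> \<xi>) \<or> \<eta> = nadd \<eta> \<xi>"
    unfolding nadd_commute[of \<eta> ozero] nadd_zero_left[OF O] .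
  \<comment> \<open>Multiplication by -1 creates no exponents beyond those of
    \<open>b\<close>.\<close>
  have v: "\<zeta> \<in> elts (nadd \<eta> \<xi>)" if "?v \<zeta> \<noteq> 0" for \<zeta>
  proof -
    from that conv_eq_zero[of "zcoeff ?n" "zcoeff b" \<zeta>] obtain \<zeta>\<^sub>1 \<zeta>\<^sub>2
      where z: "zcoeff ?n \<zeta>\<^sub>1 \<noteq> 0" "zcoeff b \<zeta>\<^sub>2 \<noteq> 0" "nadd \<zeta>\<^sub>1 \<zeta>\<^sub>2 = \<zeta>" by blast
    have "\<zeta>\<^sub>1 = ozero" using z(1) unfolding zcoeff_neg_one by (metis fun_upd_other)
    moreover have "Ord \<zeta>\<^sub>2" by (rule Ord_elem[OF O exps[OF z(2)]])
    ultimately have "\<zeta> \<in> elts \<eta>" using nadd_zero_left z(3) exps[OF z(2)] by metis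
    then show ?thesis using eta Ord_trans[OF Ord_nadd[OF O Oxi]] by metis
  qed
  have "lead_pos (\<lambda>\<zeta>. ?u \<zeta> + ?v \<zeta>)"
    unfolding lead_pos_def
    using lead_at_add_dominated[OF lead_u, of ?v, OF v] u by (intro exI[of _ "nadd \<eta> \<xi>"]) simp
  then have "\<not> qle (kpair ?n ?d) m"
    unfolding ab(1) qle_iff[OF n d ab(2,3)] by (simp add: algebra_simps)
  with x show ?thesis by blast
qed

lemma is_cut_neg_fractions:
  assumes "Ord l" "elts omega \<subseteq> elts l" "\<And>\<beta>. \<beta> \<in> elts l \<Longrightarrow> omega_pow (osucc \<beta>) \<in> elts l"
  shows "is_cut l (vset (neg_fractions l))"
  unfolding is_cut_def elts_neg_fractions
proof (intro conjI ballI)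
  have nat_l: "ord_of_nat n \<in> elts l" for n using assms(2) elts_omega by blast
  have "lead_pos (zcoeff zone)"
    unfolding zcoeff_zone lead_pos_def lead_at_def by (intro exI[of _ ozero]) auto
  \<comment> \<open>The fraction 0/1 witnesses that the cut is a proper subset.\<close>
  then have "kpair zzero zone \<in> Q_inf"
    by (rule kpair_in_Q_inf[OF zzero_in_Z_inf zone_in_Z_inf _ disjI2[OF refl] zcoeff_zone]) simp
  then have "kpair zzero zone \<in> Q_below l"
    using zzero_in_Z_inf zone_in_Z_inf nat_l
    by (simp only: Q_below_def mem_Collect_eq vfst_kpair vsnd_kpair zzero_def zone_def kpair_in_Z_below)
  moreover have "kpair zzero zone \<notin> neg_fractions l"
    using lead_pos_nonzero by (auto simp: neg_fractions_def zcoeff_zzero)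
  moreover have "neg_fractions l \<subseteq> Q_below l" by (auto simp: neg_fractions_def)
  ultimately show "neg_fractions l \<subset> Q_below l" by blast
  show "\<not> (\<exists>m\<in>neg_fractions l. \<forall>x\<in>neg_fractions l. qle x m)"
    using neg_fractions_no_greatest[OF assms] by blast
qed (rule qlt_neg_fractions)

lemma neg_ordinal_in_neg_fractions:
  assumes "elts omega \<subseteq> elts l" "Ord \<alpha>" "\<alpha> \<noteq> ozero" "\<alpha> \<in> elts l"
  shows "kpair (kpair ozero \<alpha>) zone \<in> neg_fractions l"
proof -
  let ?a = "kpair ozero \<alpha>"
  have a: "?a \<in> Z_inf" by (rule kpair_zero_left_in_Z_inf[OF assms(2)])
  have nat_l: "ord_of_nat n \<in> elts l" for n using assms(1) elts_omega by blast
  have "lead_pos (zcoeff zone)"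
    unfolding zcoeff_zone lead_pos_def lead_at_def by (intro exI[of _ ozero]) auto
  then have "kpair ?a zone \<in> Q_inf"
    by (rule kpair_in_Q_inf[OF a zone_in_Z_inf _ disjI2[OF refl] zcoeff_zone]) simp
  then have "kpair ?a zone \<in> Q_below l"
    using a zone_in_Z_inf nat_l assms(4)
    by (simp only: Q_below_def mem_Collect_eq vfst_kpair vsnd_kpair zone_def kpair_in_Z_below)
  moreover have "ozero \<in> elts \<alpha>"
    using Ord_linear[OF Ord_ord_of_nat[of 0] assms(2)] assms(3) by auto
  then have "lead_pos (\<lambda>\<zeta>. int (cnf \<alpha> \<zeta>) - int (cnf ozero \<zeta>))"
    using less_iff_cnf[OF Ord_ord_of_nat assms(2)] by blast
  then have "lead_pos (\<lambda>\<zeta>. - zcoeff ?a \<zeta>)" unfolding zcoeff_kpair by simp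
  ultimately show ?thesis by (simp only: neg_fractions_def mem_Collect_eq vfst_kpair)
qed

section \<open>Closed times-numbers and the Burali-Forti contradiction\<close>

lemma exists_cut_with_neg_ordinal:
  assumes "Ord \<alpha>" "\<alpha> \<noteq> ozero"
  shows "\<exists>L\<in>R_inf. kpair (kpair ozero \<alpha>) zone \<in> elts L"
proof -
  \<comment> \<open>A union of two ordinals is their maximum, so one binary operation encodes both
    closure conditions.\<close>
  let ?F = "\<lambda>\<beta> \<gamma>. vset (elts (nmul \<beta> \<gamma>) \<union> elts (omega_pow (osucc \<beta>)))"
  have elts_F: "elts (?F \<beta> \<gamma>) = elts (nmul \<beta> \<gamma>) \<union> elts (omega_pow (osucc \<beta>))" for \<beta> \<gamma>
    by (simp add: elts_vset is_set_Un)
  \<comment> \<open>The maximum of \<open>\<alpha>\<close> + 1 and \<open>\<omega>\<close>: the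
    first makes \<open>\<alpha>\<close> a member of \<open>l\<close>, the second makes
    \<open>l\<close> transfinite.\<close>
  let ?\<delta> = "vset (elts (osucc \<alpha>) \<union> elts omega)"
  have "Ord ?\<delta>" by (intro Ord_Un Ord_osucc Ord_omega assms)
  then obtain l where l: "Ord l" "elts ?\<delta> \<subseteq> elts l"
    and F: "\<And>\<beta> \<gamma>. \<beta> \<in> elts l \<Longrightarrow> \<gamma> \<in> elts l \<Longrightarrow> ?F \<beta> \<gamma> \<in> elts l"
    by (rule exists_closed_ordinal[where F = ?F]) (intro Ord_Un Ord_nmul Ord_omega_pow Ord_osucc, blast+)
  have \<delta>: "\<alpha> \<in> elts l" "elts omega \<subseteq> elts l"
    using l(2) by (auto simp: elts_vset is_set_Un is_set_insert)
  \<comment> \<open>Each ordinal is at most the maximum \<open>?F\<close>, which lies in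
    \<open>l\<close>.\<close>
  have closed: "nmul \<beta> \<gamma> \<in> elts l \<and> omega_pow (osucc \<beta>) \<in> elts l"
    if "\<beta> \<in> elts l" "\<gamma> \<in> elts l" for \<beta> \<gamma>
  proof -
    have O: "Ord \<beta>" "Ord \<gamma>" using that Ord_elem[OF l(1)] by auto
    show ?thesis
      using Ord_le_less_trans[OF Ord_nmul[OF O] l(1) _ F[OF that]]
        Ord_le_less_trans[OF Ord_omega_pow[OF Ord_osucc[OF O(1)]] l(1) _ F[OF that]]
      unfolding elts_F by blast
  qed
  have "transfinite_times_number l"
    unfolding transfinite_times_number_def olt_def ole_def
    using l(1) Ord_subset_iff[OF Ord_omega l(1)] \<delta>(2) closed by blast
  moreover have "is_cut l (vset (neg_fractions l))"
    using closed by (intro is_cut_neg_fractions l(1) \<delta>(2)) blast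
  ultimately have "vset (neg_fractions l) \<in> R_inf" by (auto simp: R_inf_def R_below_def)
  moreover have "kpair (kpair ozero \<alpha>) zone \<in> elts (vset (neg_fractions l))"
    unfolding elts_neg_fractions by (rule neg_ordinal_in_neg_fractions[OF \<delta>(2) assms \<delta>(1)])
  ultimately show ?thesis by blast
qed

text \<open>Taking the second coordinate of the numerator recovers \<open>\<alpha>\<close> from
  -\<open>\<alpha>\<close>/1. It suffices that the resulting image covers the ordinals; whatever
  else it contains is harmless.\<close>

lemma proper_class_R_inf: "proper_class R_inf"
  unfolding proper_class_def
proof
  assume "is_set R_inf"
  then have "is_set (\<Union>L\<in>R_inf. elts L)" by (rule is_set_UN) simp
  \<comment> \<open>Zero is added by hand, since cuts were only produced for nonzero
    \<open>\<alpha>\<close>.\<close>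
  then have U: "is_set (insert ozero ((\<lambda>q. vsnd (vfst q)) ` (\<Union>L\<in>R_inf. elts L)))"
    by (intro is_set_insert is_set_image)
  have "\<alpha> \<in> insert ozero ((\<lambda>q. vsnd (vfst q)) ` (\<Union>L\<in>R_inf. elts L))" if a: "Ord \<alpha>" for \<alpha>
  proof (cases "\<alpha> = ozero")
    case False
    from exists_cut_with_neg_ordinal[OF a False] obtain L
      where "L \<in> R_inf" "kpair (kpair ozero \<alpha>) zone \<in> elts L" by blast
    moreover have "\<alpha> = vsnd (vfst (kpair (kpair ozero \<alpha>) zone))" by simp
    ultimately show ?thesis by blast
  qed simp
  then have "is_set {\<alpha>. Ord \<alpha>}" by (intro is_set_mono[OF _ U]) blast
  with proper_class_Ord show False by blast
qed

end

theorem theorem11p24: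
  fixes elts :: "'v \<Rightarrow> 'v set"
  assumes "morse_kelley elts"
  shows "morse_kelley.proper_class elts (morse_kelley.R_inf elts)"
  by (rule morse_kelley.proper_class_R_inf[OF assms])

end
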